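(* Let $R$ be a finite Frobenius ring endowed with a homogeneous weight $w$ with real constant $\gamma$, extended additively to $R^n$. Let $C\le {}_RR^n$ be a left linear code that is a proper, regular, projective two-weight code with nonzero weights $w_1<w_2$. Then the graph $\Gamma:=\Gamma(C)$ is strongly regular and the eigenvalues $k,\rho_1,\rho_2$ of the adjacency matrix of $\Gamma$ (where $k$ is the degree of $\Gamma$, the eigenvalue of the all-ones vector, and $\rho_1,\rho_2$ are the eigenvalues having eigenvectors orthogonal to the all-ones vector) satisfy (i) $(w_2-w_1)k = w_2(|C|-1)-\gamma n|C|$; (ii) $(w_2-w_1)\rho_1 = -w_2$; (iii) $(w_2-w_1)\rho_2 = -w_2+\dfrac{\gamma|C|}{|R^\times|}$.
   Context: Rings are associative with identity $1\neq 0$; $R^\times$ is the unit group of $R$. A finite ring $R$ is Frobenius if ${}_RR\cong{}_R\hat R$ as left $R$-modules, where $\hat R=\mathrm{Hom}_{\mathbb Z}(R,\mathbb C^\times)$ is the group of additive characters with $({}^r\chi)(x)=\chi(rx)$ and $\chi^r(x)=\chi(xr)$ giving its bimodule structure (equivalently, ${}_R(R/\mathrm{Rad}\,R)\cong \mathrm{Soc}({}_RR)$). Homogeneous weight: let $\mu$ be the Möbius function on the set of left principal ideals of $R$ ordered by inclusion, i.e. $\mu(Rx,Rx)=1$, $\mu(Ry,Rx)=0$ if $Ry\not\le Rx$, and $\sum_{Ry\le Rz\le Rx}\mu(Rz,Rx)=0$ (sum over left principal ideals $Rz$) if $Ry<Rx$. For a real constant $\gamma$ the homogeneous weight is $w(x)=\gamma\left(1-\frac{\mu(0,Rx)}{|R^\times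 x|}\right)$, $x\in R$. It is extended to $R^n$ by $w(c_1,\dots,c_n)=\sum_{i=1}^n w(c_i)$. Codes: a left linear code $C\le {}_RR^n$ is a left $R$-submodule. Let $Y=(y_1|\cdots|y_n)$ be an $\ell\times n$ generator matrix of $C$, i.e. $C=\{xY: x\in R^\ell\}$ (rows need not be independent). $C$ is proper if $w(c)=0$ implies $c=0$ for all $c\in C$; regular if $\{x\cdot y_i: x\in R^\ell\}=R$ for each $i$; projective if $y_iR\ne y_jR$ for all distinct $i,j\in\{1,\dots,n\}$. These notions do not depend on the choice of $Y$. A two-weight code with nonzero weights $w_1<w_2$ is a code for which exactly the two nonzero values $w_1,w_2$ occur as weights of codewords. $\Gamma(C)$ is the graph whose vertices are the codewords of $C$, with $c,c'$ adjacent if and only if $w(c-c')=w_1$. A graph on $N$ vertices is strongly regular with parameters $(N,k,\lambda,\mu)$ if it is regular of degree $k$, every pair of adjacent vertices has exactly $\lambda$ common neighbours, and every pair of distinct non-adjacent vertices has exactly $\mu$ common neighbours (disconnected graphs and graphs with disconnected complement are allowed; these are called trivial). *)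

theory Defs
  imports Complex_Main "Jordan_Normal_Form.Char_Poly"
begin

section \<open>Finite Frobenius rings\<close>

definition ring_units :: "'a::ring_1 set" where
  "ring_units = {u. \<exists>v. u * v = 1 \<and> v * u = 1}"

definition additive_characters :: "('a::ring_1 \<Rightarrow> complex) set" where
  "additive_characters = {\<chi>. (\<forall>x. \<chi> x \<noteq> 0) \<and> (\<forall>x y. \<chi> (x + y) = \<chi> x * \<chi> y)}"

text \<open>The left module structure of the character group. The ring element multiplies the argument
  from the right: this is what makes \<^term>\<open>\<lambda>r. char_lact r\<close> a left action when the ring is not
  commutative (\<open>\<chi> (r * x)\<close> would give a right action).\<close>

definition char_lact :: "'a::ring_1 \<Rightarrow> ('a \<Rightarrow> complex) \<Rightarrow> ('a \<Rightarrow> complex)" where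
  "char_lact r \<chi> = (\<lambda>x. \<chi> (x * r))"

lemma char_lact_mult: "char_lact (r * s) \<chi> = char_lact r (char_lact s \<chi>)"
  by (simp add: char_lact_def mult.assoc)

text \<open>The group of characters is written multiplicatively (pointwise product).\<close>

definition frobenius_ring :: "'a::{ring_1,finite} itself \<Rightarrow> bool" where
  "frobenius_ring _ \<longleftrightarrow>
    (\<exists>\<phi> :: 'a \<Rightarrow> ('a \<Rightarrow> complex).
       bij_betw \<phi> UNIV additive_characters \<and>
       (\<forall>a b. \<phi> (a + b) = (\<lambda>x. \<phi> a x * \<phi> b x)) \<and>
       (\<forall>r a. \<phi> (r * a) = char_lact r (\<phi> a)))"


section \<open>The homogeneous weight\<close>

definition left_principal :: "'a::ring_1 \<Rightarrow> 'a set" where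
  "left_principal x = range (\<lambda>r. r * x)"

text \<open>The recursion solves \<open>(\<Sum>I \<subseteq> K \<subseteq> J. \<mu>(K, J)) = 0\<close> for \<open>\<mu>(I, J)\<close>, where \<open>K\<close> ranges over the
  left principal ideals; only the values at left principal ideals \<open>I\<close>, \<open>J\<close> are meaningful.\<close>

function lmoebius :: "'a::{ring_1,finite} set \<Rightarrow> 'a set \<Rightarrow> int" where
  "lmoebius I J =
    (if I = J then 1
     else if I \<subset> J
       then - (\<Sum>K \<in> {K \<in> range left_principal. I \<subset> K \<and> K \<subseteq> J}. lmoebius K J)
     else 0)"
  by auto
termination
proof (relation "measure (\<lambda>(I, J). card (- I))")
  show "((K, J), (I, J)) \<in> measure (\<lambda>(I, J). card (- I))"
    if "K \<in> {K \<in> range left_principal. I \<subset> K \<and> K \<subseteq> J}" for I J K :: "'a set"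
    using that by (auto intro!: psubset_card_mono)
qed simp

declare lmoebius.simps [simp del]

lemma lmoebius_refl: "lmoebius I I = 1"
  by (simp add: lmoebius.simps)

lemma lmoebius_not_subset: "\<not> I \<subseteq> J \<Longrightarrow> lmoebius I J = 0"
  by (subst lmoebius.simps) auto

lemma lmoebius_sum:
  assumes "I \<in> range left_principal" "I \<subset> J"
  shows "(\<Sum>K \<in> {K \<in> range left_principal. I \<subseteq> K \<and> K \<subseteq> J}. lmoebius K J) = 0"
proof -
  have "{K \<in> range left_principal. I \<subseteq> K \<and> K \<subseteq> J} =
      insert I {K \<in> range left_principal. I \<subset> K \<and> K \<subseteq> J}"
    using assms by auto
  then show ?thesis
    using assms by (simp add: lmoebius.simps [of I J])
qed

definition hom_weight :: "real \<Rightarrow> 'a::{ring_1,finite} \<Rightarrow> real" where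
  "hom_weight \<gamma> x =
    \<gamma> * (1 - of_int (lmoebius {0} (left_principal x)) / real (card ((\<lambda>u. u * x) ` ring_units)))"

definition hom_weight_vec :: "real \<Rightarrow> 'a::{ring_1,finite} vec \<Rightarrow> real" where
  "hom_weight_vec \<gamma> c = (\<Sum>i<dim_vec c. hom_weight \<gamma> (c $ i))"


section \<open>Codes\<close>

definition left_linear_code :: "nat \<Rightarrow> 'a::ring_1 vec set \<Rightarrow> bool" where
  "left_linear_code n C \<longleftrightarrow>
    C \<subseteq> carrier_vec n \<and> 0\<^sub>v n \<in> C \<and> (\<forall>c\<in>C. \<forall>d\<in>C. c + d \<in> C) \<and> (\<forall>r. \<forall>c\<in>C. r \<cdot>\<^sub>v c \<in> C)"

text \<open>The vector with entries \<^term>\<open>x \<bullet> col Y j\<close> is the row vector \<open>x Y\<close>. Over a noncommutative ring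
  it differs from \<^term>\<open>transpose_mat Y *\<^sub>v x\<close>, where the factors are in the other order.\<close>

definition generator_matrix :: "nat \<Rightarrow> nat \<Rightarrow> 'a::ring_1 mat \<Rightarrow> 'a vec set \<Rightarrow> bool" where
  "generator_matrix l n Y C \<longleftrightarrow>
    Y \<in> carrier_mat l n \<and> C = (\<lambda>x. vec n (\<lambda>j. x \<bullet> col Y j)) ` carrier_vec l"

definition right_span :: "'a::ring_1 vec \<Rightarrow> 'a vec set" where
  "right_span y = range (\<lambda>r. map_vec (\<lambda>a. a * r) y)"

definition proper_code :: "real \<Rightarrow> nat \<Rightarrow> 'a::{ring_1,finite} vec set \<Rightarrow> bool" where
  "proper_code \<gamma> n C \<longleftrightarrow> (\<forall>c\<in>C. hom_weight_vec \<gamma> c = 0 \<longrightarrow> c = 0\<^sub>v n)"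

text \<open>Regularity and projectivity are properties of some, equivalently of every, generator matrix;
  see \<open>regular_code_iff\<close> and \<open>projective_code_iff\<close> below.\<close>

definition regular_code :: "nat \<Rightarrow> 'a::ring_1 vec set \<Rightarrow> bool" where
  "regular_code n C \<longleftrightarrow>
    (\<exists>l Y. generator_matrix l n Y C \<and> (\<forall>j<n. (\<lambda>x. x \<bullet> col Y j) ` carrier_vec l = UNIV))"

definition projective_code :: "nat \<Rightarrow> 'a::ring_1 vec set \<Rightarrow> bool" where
  "projective_code n C \<longleftrightarrow>
    (\<exists>l Y. generator_matrix l n Y C \<and>
       (\<forall>i<n. \<forall>j<n. i \<noteq> j \<longrightarrow> right_span (col Y i) \<noteq> right_span (col Y j)))"

definition two_weight_code :: "real \<Rightarrow> 'a::{ring_1,finite} vec set \<Rightarrow> real \<Rightarrow> real \<Rightarrow> bool" where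
  "two_weight_code \<gamma> C w1 w2 \<longleftrightarrow>
    w1 < w2 \<and> {hom_weight_vec \<gamma> c | c. c \<in> C \<and> hom_weight_vec \<gamma> c \<noteq> 0} = {w1, w2}"

lemma generator_matrix_exists:
  fixes C :: "'a::{ring_1,finite} vec set"
  assumes C: "left_linear_code n C"
  shows "\<exists>l Y. generator_matrix l n Y C"
proof -
  have sub: "C \<subseteq> carrier_vec n"
    using C by (simp add: left_linear_code_def)
  have "carrier_vec n \<subseteq> (\<lambda>f. vec n f) ` ({..<n} \<rightarrow>\<^sub>E (UNIV :: 'a set))"
  proof
    fix v :: "'a vec" assume "v \<in> carrier_vec n"
    then have "v = vec n (restrict (($) v) {..<n})"
      by (intro eq_vecI) auto
    then show "v \<in> (\<lambda>f. vec n f) ` ({..<n} \<rightarrow>\<^sub>E UNIV)"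
      using image_eqI [of v "vec n" "restrict (($) v) {..<n}"] by simp
  qed
  then have "finite (carrier_vec n :: 'a vec set)"
    by (rule finite_subset) (simp add: finite_PiE)
  then have "finite C"
    using sub finite_subset by blast
  then obtain cs where cs: "set cs = C"
    using finite_list by blast
  define l where "l = length cs"
  define Y where "Y = mat l n (\<lambda>(i, j). cs ! i $ j)"
  have Y: "Y \<in> carrier_mat l n" by (simp add: Y_def)
  have sp: "x \<bullet> col Y j = (\<Sum>i<l. x $ i * cs ! i $ j)" if "j < n" for x j
    using that by (simp add: scalar_prod_def Y_def lessThan_atLeast0)
  have csC: "cs ! i \<in> C" if "i < l" for i
    using that cs by (auto simp: l_def)
  have in_C: "vec n (\<lambda>j. x \<bullet> col Y j) \<in> C" for x
  proof -
    have "m \<le> l \<Longrightarrow> vec n (\<lambda>j. \<Sum>i<m. x $ i * cs ! i $ j) \<in> C" for m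
    proof (induction m)
      case 0
      have "vec n (\<lambda>j. \<Sum>i<0. x $ i * cs ! i $ j) = 0\<^sub>v n" by auto
      then show ?case using C by (metis left_linear_code_def)
    next
      case (Suc m)
      have d: "dim_vec (cs ! m) = n"
        using csC [of m] sub Suc.prems by auto
      have "vec n (\<lambda>j. \<Sum>i<Suc m. x $ i * cs ! i $ j) =
          vec n (\<lambda>j. \<Sum>i<m. x $ i * cs ! i $ j) + x $ m \<cdot>\<^sub>v cs ! m"
        by (intro eq_vecI) (auto simp: d)
      then show ?case
        using C Suc csC [of m] by (simp add: left_linear_code_def)
    qed
    moreover have "vec n (\<lambda>j. x \<bullet> col Y j) = vec n (\<lambda>j. \<Sum>i<l. x $ i * cs ! i $ j)"
      by (intro eq_vecI) (auto simp: sp)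
    ultimately show ?thesis by simp
  qed
  have gen: "\<exists>x\<in>carrier_vec l. c = vec n (\<lambda>j. x \<bullet> col Y j)" if c: "c \<in> C" for c
  proof -
    obtain i where i: "i < l" "cs ! i = c"
      using c cs by (auto simp: l_def in_set_conv_nth)
    have "c = vec n (\<lambda>j. unit_vec l i \<bullet> col Y j)"
    proof (intro eq_vecI)
      show "dim_vec c = dim_vec (vec n (\<lambda>j. unit_vec l i \<bullet> col Y j))"
        using c sub by auto
      fix j assume "j < dim_vec (vec n (\<lambda>j. unit_vec l i \<bullet> col Y j))"
      then have "j < n" by simp
      moreover from this have "unit_vec l i \<bullet> col Y j = col Y j $ i"
        using i Y by (intro scalar_prod_left_unit) auto
      ultimately show "c $ j = vec n (\<lambda>j. unit_vec l i \<bullet> col Y j) $ j"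
        using i by (simp add: Y_def)
    qed
    then show ?thesis by (rule bexI) simp
  qed
  have "C = (\<lambda>x. vec n (\<lambda>j. x \<bullet> col Y j)) ` carrier_vec l"
  proof
    show "C \<subseteq> (\<lambda>x. vec n (\<lambda>j. x \<bullet> col Y j)) ` carrier_vec l"
      using gen by blast
    show "(\<lambda>x. vec n (\<lambda>j. x \<bullet> col Y j)) ` carrier_vec l \<subseteq> C"
      using in_C by blast
  qed
  then show ?thesis
    using Y by (auto simp: generator_matrix_def)
qed

lemma regular_code_iff:
  assumes "generator_matrix l n Y C"
  shows "regular_code n C \<longleftrightarrow> (\<forall>j<n. (\<lambda>x. x \<bullet> col Y j) ` carrier_vec l = UNIV)"
proof -
  have eq: "(\<lambda>x. x \<bullet> col Y j) ` carrier_vec l = (\<lambda>c. c $ j) ` C"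
    if "generator_matrix l n Y C" "j < n" for l Y j
    using that by (simp add: generator_matrix_def image_image)
  have key: "(\<forall>j<n. (\<lambda>x. x \<bullet> col Y j) ` carrier_vec l = UNIV) \<longleftrightarrow> (\<forall>j<n. (\<lambda>c. c $ j) ` C = UNIV)"
    if "generator_matrix l n Y C" for l Y
    using eq [OF that] by simp
  show ?thesis
  proof
    assume "regular_code n C"
    then obtain l' Y' where Y': "generator_matrix l' n Y' C" and P: "\<forall>j<n. (\<lambda>x. x \<bullet> col Y' j) ` carrier_vec l' = UNIV"
      unfolding regular_code_def by (elim exE conjE)
    show "\<forall>j<n. (\<lambda>x. x \<bullet> col Y j) ` carrier_vec l = UNIV"
      using P unfolding key [OF Y'] key [OF assms] .
  next
    assume "\<forall>j<n. (\<lambda>x. x \<bullet> col Y j) ` carrier_vec l = UNIV"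
    with assms show "regular_code n C"
      unfolding regular_code_def by (intro exI conjI)
  qed
qed

lemma col_in_right_span_iff:
  assumes Y: "generator_matrix l n Y C" and i: "i < n" and j: "j < n"
  shows "col Y i \<in> right_span (col Y j) \<longleftrightarrow> (\<exists>r. \<forall>c\<in>C. c $ i = c $ j * r)"
proof -
  have car: "Y \<in> carrier_mat l n" and C: "C = (\<lambda>x. vec n (\<lambda>j. x \<bullet> col Y j)) ` carrier_vec l"
    using Y by (auto simp: generator_matrix_def)
  have "col Y i = map_vec (\<lambda>a. a * r) (col Y j) \<longleftrightarrow> (\<forall>c\<in>C. c $ i = c $ j * r)" for r
  proof
    assume eq: "col Y i = map_vec (\<lambda>a. a * r) (col Y j)"
    have "x \<bullet> col Y i = x \<bullet> col Y j * r" for x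
      unfolding eq by (simp add: scalar_prod_def sum_distrib_right mult.assoc)
    then show "\<forall>c\<in>C. c $ i = c $ j * r"
      using i j by (auto simp: C)
  next
    assume *: "\<forall>c\<in>C. c $ i = c $ j * r"
    show "col Y i = map_vec (\<lambda>a. a * r) (col Y j)"
    proof (intro eq_vecI)
      fix k assume "k < dim_vec (map_vec (\<lambda>a. a * r) (col Y j))"
      then have k: "k < l" using car by simp
      have u: "unit_vec l k \<bullet> col Y m = col Y m $ k" for m
        using k car by (intro scalar_prod_left_unit) auto
      have "vec n (\<lambda>j. unit_vec l k \<bullet> col Y j) \<in> C"
        unfolding C by (rule imageI) simp
      from bspec [OF * this] show "col Y i $ k = map_vec (\<lambda>a. a * r) (col Y j) $ k"
        using i j k car by (simp add: u del: index_col)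
    qed simp
  qed
  then show ?thesis
    by (auto simp: right_span_def)
qed

lemma right_span_eq_iff: "right_span y = right_span z \<longleftrightarrow> y \<in> right_span z \<and> z \<in> right_span y"
proof -
  have refl: "y \<in> right_span y" for y :: "'a vec"
    unfolding right_span_def by (rule range_eqI [of _ _ 1]) auto
  have sub: "right_span y \<subseteq> right_span z" if yz: "y \<in> right_span z" for y z :: "'a vec"
  proof
    fix v assume "v \<in> right_span y"
    then obtain r s where v: "v = map_vec (\<lambda>a. a * r) y" and y: "y = map_vec (\<lambda>a. a * s) z"
      using yz by (auto simp: right_span_def)
    have "v = map_vec (\<lambda>a. a * (s * r)) z"
      unfolding v y by (intro eq_vecI) (auto simp: mult.assoc)
    then show "v \<in> right_span z"
      by (auto simp: right_span_def)
  qed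
  show ?thesis
    using refl sub by blast
qed

lemma projective_code_iff:
  assumes "generator_matrix l n Y C"
  shows "projective_code n C \<longleftrightarrow>
    (\<forall>i<n. \<forall>j<n. i \<noteq> j \<longrightarrow> right_span (col Y i) \<noteq> right_span (col Y j))"
proof -
  have eq: "right_span (col Y i) = right_span (col Y j) \<longleftrightarrow>
      (\<exists>r. \<forall>c\<in>C. c $ i = c $ j * r) \<and> (\<exists>r. \<forall>c\<in>C. c $ j = c $ i * r)"
    if "generator_matrix l n Y C" "i < n" "j < n" for l Y i j
    unfolding right_span_eq_iff col_in_right_span_iff [OF that]
      col_in_right_span_iff [OF that(1,3,2)] ..
  let ?P = "\<lambda>i j. (\<exists>r. \<forall>c\<in>C. c $ i = c $ j * r) \<and> (\<exists>r. \<forall>c\<in>C. c $ j = c $ i * r)"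
  have key: "(\<forall>i<n. \<forall>j<n. i \<noteq> j \<longrightarrow> right_span (col Y i) \<noteq> right_span (col Y j)) \<longleftrightarrow>
      (\<forall>i<n. \<forall>j<n. i \<noteq> j \<longrightarrow> \<not> ?P i j)"
    if "generator_matrix l n Y C" for l Y
    by (simp add: eq [OF that])
  show ?thesis
  proof
    assume "projective_code n C"
    then obtain l' Y' where Y': "generator_matrix l' n Y' C" and P: "\<forall>i<n. \<forall>j<n. i \<noteq> j \<longrightarrow> right_span (col Y' i) \<noteq> right_span (col Y' j)"
      unfolding projective_code_def by (elim exE conjE)
    show "\<forall>i<n. \<forall>j<n. i \<noteq> j \<longrightarrow> right_span (col Y i) \<noteq> right_span (col Y j)"
      using P unfolding key [OF Y'] key [OF assms] .
  next
    assume "\<forall>i<n. \<forall>j<n. i \<noteq> j \<longrightarrow> right_span (col Y i) \<noteq> right_span (col Y j)"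
    with assms show "projective_code n C"
      unfolding projective_code_def by (intro exI conjI)
  qed
qed


section \<open>Graphs\<close>

text \<open>A graph is a vertex set together with an adjacency relation. The parameters of a strongly
  regular graph do not exclude disconnected graphs or graphs with disconnected complement.\<close>

definition strongly_regular ::
    "'v set \<Rightarrow> ('v \<Rightarrow> 'v \<Rightarrow> bool) \<Rightarrow> nat \<Rightarrow> nat \<Rightarrow> nat \<Rightarrow> nat \<Rightarrow> bool" where
  "strongly_regular V adj N k l m \<longleftrightarrow>
    finite V \<and> card V = N \<and>
    (\<forall>x\<in>V. \<not> adj x x) \<and> (\<forall>x\<in>V. \<forall>y\<in>V. adj x y \<longrightarrow> adj y x) \<and>
    (\<forall>x\<in>V. card {z\<in>V. adj x z} = k) \<and>
    (\<forall>x\<in>V. \<forall>y\<in>V. adj x y \<longrightarrow> card {z\<in>V. adj x z \<and> adj y z} = l) \<and>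
    (\<forall>x\<in>V. \<forall>y\<in>V. x \<noteq> y \<and> \<not> adj x y \<longrightarrow> card {z\<in>V. adj x z \<and> adj y z} = m)"

text \<open>The list enumerates the vertices and thereby fixes the order of the rows and columns.\<close>

definition adjacency_mat :: "('v \<Rightarrow> 'v \<Rightarrow> bool) \<Rightarrow> 'v list \<Rightarrow> real mat" where
  "adjacency_mat adj vs =
    mat (length vs) (length vs) (\<lambda>(i, j). if adj (vs ! i) (vs ! j) then 1 else 0)"

abbreviation all_ones :: "nat \<Rightarrow> real vec" where
  "all_ones N \<equiv> vec N (\<lambda>_. 1)"

definition code_adj :: "real \<Rightarrow> real \<Rightarrow> 'a::{ring_1,finite} vec \<Rightarrow> 'a vec \<Rightarrow> bool" where
  "code_adj \<gamma> w1 c d \<longleftrightarrow> hom_weight_vec \<gamma> (c - d) = w1"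

end

theory Submission
  imports Defs
begin

text \<open>
  The homogeneous weight is a character sum, so a code turns into a set of characters of its own
  additive group; the adjacency matrix is then a combination of \<open>I\<close>, the all-ones matrix \<open>J\<close> and
  the orthogonal projection onto the span of these characters.

  A Frobenius ring has a character \<open>\<chi>\<close> that is trivial on no nonzero one-sided ideal.
  Moebius inversion over the principal left ideals gives
  \<open>w(x) = \<gamma> (1 - (\<Sum>u. \<chi>(x u)) / U)\<close>, where \<open>u\<close> runs over the units and \<open>U\<close> is their number
  (\<open>hom_weight_eq_character_sum\<close>). The inversion first yields the sum of \<open>\<chi>\<close> over the generators
  of \<open>R x\<close>, and needs that these form a single unit orbit (\<open>generators_left_principal\<close>).

  Summing over coordinates, \<open>w(c) = \<gamma> (n - b(c) / U)\<close>, where \<open>b\<close> is the sum of the \<open>n U\<close>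
  characters \<open>c \<mapsto> \<chi>(c_i u)\<close> of \<open>C\<close>. Regularity makes them nontrivial and separates different
  units at one coordinate; projectivity separates different coordinates
  (\<open>code_characters_orthogonal\<close>). By orthogonality the matrix \<open>B = (b(x - y))\<close> satisfies
  \<open>B J = 0\<close> and \<open>B\<^sup>2 = |C| B\<close> (\<open>code_kernel_row_sum\<close>, \<open>code_kernel_square\<close>).

  On the other hand the matrix of weights of differences is \<open>w\<^sub>1 A + w\<^sub>2 (J - I - A)\<close>, with \<open>A\<close>
  the adjacency matrix, because zero has weight \<open>0\<close> and every other codeword has weight \<open>w\<^sub>1\<close> or
  \<open>w\<^sub>2\<close>. Comparing the two expressions,
  \<open>(w\<^sub>2 - w\<^sub>1) A = - w\<^sub>2 I + (w\<^sub>2 - \<gamma> n) J + (\<gamma> / U) B\<close>.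
  Hence \<open>A\<^sup>2\<close> is a combination of \<open>I\<close>, \<open>J\<close> and \<open>A\<close>, which is strong regularity. On the
  complement of the all-ones vector, \<open>J\<close> is zero and \<open>B\<close> has only the eigenvalues \<open>0\<close> and
  \<open>|C|\<close>, which gives the two restricted eigenvalues. Both occur: \<open>B\<close> is not zero, and
  \<open>B = |C| I - J\<close> would give all nonzero codewords the same weight.
\<close>


section \<open>Graphs from a multiple of a projection\<close>

text \<open>The square of \<open>\<beta> I + \<delta> J + \<alpha> B\<close> is again a combination of \<open>I\<close>, \<open>J\<close> and \<open>B\<close>, so the number
  of common neighbours of two vertices depends only on their entry of \<open>B\<close>, hence only on
  whether they are equal, adjacent or neither. The floors merely turn the resulting real numbers,
  whose integrality is part of the conclusion, into natural numbers.\<close>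

lemma strongly_regular_if_kernel:
  fixes B :: "'v \<Rightarrow> 'v \<Rightarrow> real"
  assumes fin: "finite V"
    and irrefl: "\<And>x. x \<in> V \<Longrightarrow> \<not> adj x x"
    and adj: "\<And>x y. x \<in> V \<Longrightarrow> y \<in> V \<Longrightarrow>
      of_bool (adj x y) = \<beta> * of_bool (x = y) + \<delta> + \<alpha> * B x y"
    and sym: "\<And>x y. x \<in> V \<Longrightarrow> y \<in> V \<Longrightarrow> B x y = B y x"
    and row: "\<And>x. x \<in> V \<Longrightarrow> (\<Sum>z\<in>V. B x z) = 0"
    and square: "\<And>x y. x \<in> V \<Longrightarrow> y \<in> V \<Longrightarrow> (\<Sum>z\<in>V. B x z * B z y) = real (card V) * B x y"
  shows "strongly_regular V adj (card V)
    (nat \<lfloor>\<beta> + \<delta> * card V\<rfloor>)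
    (nat \<lfloor>2 * \<beta> * \<delta> + \<delta>\<^sup>2 * card V + (2 * \<beta> + \<alpha> * card V) * (1 - \<delta>)\<rfloor>)
    (nat \<lfloor>2 * \<beta> * \<delta> + \<delta>\<^sup>2 * card V - (2 * \<beta> + \<alpha> * card V) * \<delta>\<rfloor>)"
proof -
  have adj_sym: "adj y x" if "x \<in> V" "y \<in> V" "adj x y" for x y
  proof -
    have "(of_bool (adj x y) :: real) = of_bool (adj y x)"
      unfolding adj[OF that(1,2)] adj[OF that(2,1)] sym[OF that(1,2)] by auto
    then show ?thesis using that by simp
  qed
  have card_eq: "real (card {z \<in> V. P z}) = (\<Sum>z\<in>V. of_bool (P z))" for P
    using sum.inter_filter[OF fin, of "\<lambda>_. 1::real" P] by (simp add: of_bool_def)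
  have degree: "real (card {z \<in> V. adj x z}) = \<beta> + \<delta> * card V" if x: "x \<in> V" for x
  proof -
    have "(\<Sum>z\<in>V. of_bool (adj x z)) = (\<Sum>z\<in>V. \<beta> * of_bool (x = z) + \<delta> + \<alpha> * B x z)"
      using x by (intro sum.cong) (auto simp: adj)
    also have "\<dots> = \<beta> + \<delta> * card V + \<alpha> * (\<Sum>z\<in>V. B x z)"
      using fin x by (simp add: sum.distrib flip: sum_distrib_left)
    finally show ?thesis using x by (simp add: card_eq row)
  qed
  have common: "real (card {z \<in> V. adj x z \<and> adj y z}) =
      2 * \<beta> * \<delta> + \<delta>\<^sup>2 * card V + (2 * \<beta> + \<alpha> * card V) * (of_bool (adj x y) - \<delta>)"
    if x: "x \<in> V" and y: "y \<in> V" and ne: "x \<noteq> y" for x y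
  proof -
    have "(\<Sum>z\<in>V. of_bool (adj x z \<and> adj y z)) =
        (\<Sum>z\<in>V. (of_bool (adj x z) :: real) * of_bool (adj y z))"
      by (intro sum.cong) auto
    also have "\<dots> = (\<Sum>z\<in>V. \<beta> * \<delta> * of_bool (x = z) + \<beta> * \<delta> * of_bool (y = z)
        + \<alpha> * \<beta> * (B y z * of_bool (x = z)) + \<alpha> * \<beta> * (B x z * of_bool (y = z))
        + \<delta>\<^sup>2 + \<alpha> * \<delta> * B x z + \<alpha> * \<delta> * B y z + \<alpha>\<^sup>2 * (B x z * B z y))"
      using x y ne
      by (intro sum.cong refl) (auto simp: adj sym[of y] algebra_simps power2_eq_square)
    also have "\<dots> = 2 * \<beta> * \<delta> + \<alpha> * \<beta> * B y x + \<alpha> * \<beta> * B x y + \<delta>\<^sup>2 * card V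
        + \<alpha>\<^sup>2 * (card V * B x y)"
    proof -
      have delta: "(\<Sum>z\<in>V. f z * of_bool (t = z)) = f t" if "t \<in> V" for t and f :: "'v \<Rightarrow> real"
        using fin that by (simp add: of_bool_def if_distrib cong: if_cong)
      have delta1: "(\<Sum>z\<in>V. of_bool (t = z)) = (1 :: real)" if "t \<in> V" for t
        using delta[OF that, of "\<lambda>_. 1"] by simp
      show ?thesis
        using x y by (simp add: sum.distrib delta delta1 row square flip: sum_distrib_left)
    qed
    also have "\<dots> = 2 * \<beta> * \<delta> + \<delta>\<^sup>2 * card V + (2 * \<beta> + \<alpha> * card V) * (\<alpha> * B x y)"
      using sym[OF x y] by (simp add: algebra_simps power2_eq_square)
    also have "\<alpha> * B x y = of_bool (adj x y) - \<delta>"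
      using adj[OF x y] ne by simp
    finally show ?thesis by (simp add: card_eq)
  qed
  have nat_eq: "m = nat \<lfloor>r\<rfloor>" if "real m = r" for m r
    using that by auto
  show ?thesis
    unfolding strongly_regular_def
  proof (intro conjI ballI impI)
    fix x y assume xy: "x \<in> V" "y \<in> V"
    show "adj y x" if "adj x y"
      using xy that by (rule adj_sym)
    show "card {z \<in> V. adj x z \<and> adj y z} =
        nat \<lfloor>2 * \<beta> * \<delta> + \<delta>\<^sup>2 * card V + (2 * \<beta> + \<alpha> * card V) * (1 - \<delta>)\<rfloor>" if "adj x y"
    proof -
      have "x \<noteq> y" using irrefl[OF xy(1)] that by blast
      from common[OF xy this] that show ?thesis by (intro nat_eq) simp
    qed
    show "card {z \<in> V. adj x z \<and> adj y z} =
        nat \<lfloor>2 * \<beta> * \<delta> + \<delta>\<^sup>2 * card V - (2 * \<beta> + \<alpha> * card V) * \<delta>\<rfloor>"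
      if "x \<noteq> y \<and> \<not> adj x y"
      using common[OF xy] that by (intro nat_eq) simp
  next
    fix x assume "x \<in> V"
    then show "\<not> adj x x" "card {z \<in> V. adj x z} = nat \<lfloor>\<beta> + \<delta> * card V\<rfloor>"
      by (rule irrefl, rule nat_eq[OF degree])
  qed (simp_all add: fin)
qed

text \<open>The matrix \<open>P\<close> is \<open>N\<close> times the orthogonal projection onto its image, which lies in the
  complement of the all-ones vector. An eigenvector that is not orthogonal to the all-ones vector
  has the eigenvalue of that vector, since \<open>A\<close> has constant column sums; for the others only
  the eigenvalues \<open>0\<close> and \<open>N\<close> of \<open>P\<close> matter. The last two assumptions say that the image of \<open>P\<close>
  is neither zero nor the whole complement.\<close>

lemma spectrum_if_kernel:
  fixes P :: "nat \<Rightarrow> nat \<Rightarrow> real" and \<alpha> \<beta> \<delta> :: real and N :: nat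
  defines "A \<equiv> mat N N (\<lambda>(i, j). \<beta> * of_bool (i = j) + \<delta> + \<alpha> * P i j)"
  assumes N: "N > 0"
    and sym: "\<And>i j. i < N \<Longrightarrow> j < N \<Longrightarrow> P i j = P j i"
    and row: "\<And>i. i < N \<Longrightarrow> (\<Sum>k<N. P i k) = 0"
    and square: "\<And>i j. i < N \<Longrightarrow> j < N \<Longrightarrow> (\<Sum>k<N. P i k * P k j) = real N * P i j"
    and nonzero: "\<exists>i<N. \<exists>j<N. P i j \<noteq> 0"
    and not_all: "\<exists>i<N. \<exists>j<N. P i j \<noteq> real N * of_bool (i = j) - 1"
  shows "eigenvector A (all_ones N) (\<beta> + \<delta> * N)"
    and "{e. \<exists>v. eigenvector A v e \<and> v \<bullet> all_ones N = 0} = {\<beta>, \<beta> + \<alpha> * N}"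
    and "{e. eigenvalue A e} = {\<beta> + \<delta> * N, \<beta>, \<beta> + \<alpha> * N}"
proof -
  define Q where "Q v i = (\<Sum>j<N. P i j * v $ j)" for v :: "real vec" and i
  define S where "S v = (\<Sum>j<N. v $ j)" for v :: "real vec"
  have dim: "dim_row A = N" "dim_col A = N" by (simp_all add: A_def)
  have delta: "(\<Sum>j<N. of_bool (i = j) * f j) = f i" "(\<Sum>j<N. f j * of_bool (i = j)) = f i"
     "(\<Sum>j<N. f j * of_bool (j = i)) = f i"
    if "i < N" for i and f :: "nat \<Rightarrow> real"
    using that by (simp_all add: of_bool_def if_distrib if_distribR cong: if_cong)
  have inner: "v \<bullet> all_ones N = S v" for v
    by (simp add: scalar_prod_def S_def lessThan_atLeast0)
  have mult: "(A *\<^sub>v v) $ i = \<beta> * v $ i + \<delta> * S v + \<alpha> * Q v i"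
    if "v \<in> carrier_vec N" "i < N" for v i
  proof -
    have "(A *\<^sub>v v) $ i = (\<Sum>j<N. (\<beta> * of_bool (i = j) + \<delta> + \<alpha> * P i j) * v $ j)"
      using that by (simp add: A_def scalar_prod_def lessThan_atLeast0)
    also have "\<dots> = (\<Sum>j<N. of_bool (i = j) * (\<beta> * v $ j) + \<delta> * v $ j + \<alpha> * (P i j * v $ j))"
      by (intro sum.cong) (auto simp: algebra_simps)
    also have "\<dots> = \<beta> * v $ i + \<delta> * S v + \<alpha> * Q v i"
      by (simp only: sum.distrib delta(1)[OF that(2)] S_def Q_def sum_distrib_left)
    finally show ?thesis .
  qed
  have eigI: "eigenvector A v e"
    if "v \<in> carrier_vec N" "i < N" "v $ i \<noteq> 0"
      "\<And>i. i < N \<Longrightarrow> \<beta> * v $ i + \<delta> * S v + \<alpha> * Q v i = e * v $ i" for v e i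
    unfolding eigenvector_def using that mult[OF that(1)] dim
    by (auto intro!: eq_vecI simp del: index_mult_mat_vec)
  have sum_Q: "(\<Sum>i<N. Q v i) = 0" for v
  proof -
    have "(\<Sum>i<N. Q v i) = (\<Sum>j<N. (\<Sum>i<N. P j i) * v $ j)"
      unfolding Q_def by (subst sum.swap) (auto intro!: sum.cong simp: sum_distrib_right sym)
    also have "\<dots> = 0" by (simp add: row)
    finally show ?thesis .
  qed
  have QQ: "(\<Sum>j<N. P i j * Q v j) = N * Q v i" if "i < N" for v i
  proof -
    have "(\<Sum>j<N. P i j * Q v j) = (\<Sum>k<N. (\<Sum>j<N. P i j * P j k) * v $ k)"
      unfolding Q_def sum_distrib_left by (subst sum.swap) (simp add: sum_distrib_right mult.assoc)
    also have "\<dots> = (\<Sum>k<N. N * (P i k * v $ k))"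
      using that by (intro sum.cong) (auto simp: square)
    finally show ?thesis by (simp add: Q_def sum_distrib_left)
  qed
  have ev: "e * v $ i = \<beta> * v $ i + \<delta> * S v + \<alpha> * Q v i"
    if "eigenvector A v e" "i < N" for v e i
    using that mult[of v i] dim by (auto simp: eigenvector_def simp del: index_mult_mat_vec)
  have not_orthogonal: "e = \<beta> + \<delta> * N" if E: "eigenvector A v e" and "S v \<noteq> 0" for v e
  proof -
    have "e * S v = (\<Sum>i<N. \<beta> * v $ i + \<delta> * S v + \<alpha> * Q v i)"
      unfolding S_def sum_distrib_left using ev[OF E] by (intro sum.cong) (auto simp: S_def sum_distrib_left)
    also have "\<dots> = (\<beta> + \<delta> * N) * S v + \<alpha> * (\<Sum>i<N. Q v i)"
      by (simp add: sum.distrib S_def algebra_simps flip: sum_distrib_left)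
    finally show ?thesis using that(2) by (simp add: sum_Q)
  qed
  have orthogonal: "e \<in> {\<beta>, \<beta> + \<alpha> * N}" if E: "eigenvector A v e" and S0: "S v = 0" for v e
  proof -
    have eq: "(e - \<beta>) * v $ i = \<alpha> * Q v i" if "i < N" for i
      using ev[OF E that] S0 by (simp add: algebra_simps)
    have eq2: "(e - \<beta>) * Q v m = \<alpha> * N * Q v m" if m: "m < N" for m
    proof -
      have "(e - \<beta>) * Q v m = (\<Sum>j<N. P m j * ((e - \<beta>) * v $ j))"
        by (simp add: Q_def sum_distrib_left mult_ac)
      also have "\<dots> = (\<Sum>j<N. \<alpha> * (P m j * Q v j))"
        by (intro sum.cong) (auto simp: eq)
      also have "\<dots> = \<alpha> * (N * Q v m)" by (simp only: QQ[OF m] flip: sum_distrib_left)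
      finally show ?thesis by simp
    qed
    obtain i where i: "i < N" "v $ i \<noteq> 0"
    proof (rule ccontr)
      assume "\<not> thesis"
      then have "v = 0\<^sub>v N"
        using that E dim by (intro eq_vecI) (auto simp: eigenvector_def)
      then show False using E dim by (simp add: eigenvector_def)
    qed
    show ?thesis
    proof (cases "Q v i = 0")
      case True
      then show ?thesis using eq[OF i(1)] i by simp
    next
      case False
      then show ?thesis using eq2[OF i(1)] by auto
    qed
  qed
  show ones: "eigenvector A (all_ones N) (\<beta> + \<delta> * N)"
    using N by (intro eigI[of _ 0]) (auto simp: S_def Q_def row)
  have ex2: "\<exists>v. eigenvector A v (\<beta> + \<alpha> * N) \<and> S v = 0"
  proof -
    obtain i j where ij: "i < N" "j < N" "P i j \<noteq> 0" using nonzero by blast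
    \<comment> \<open>The columns of \<open>P\<close> span its image.\<close>
    let ?v = "vec N (\<lambda>i. P i j)"
    have S0: "S ?v = 0"
      using row[OF ij(2)] sym[OF _ ij(2)] by (simp add: S_def)
    have "Q ?v m = N * P m j" if "m < N" for m
      using square[OF that ij(2)] by (simp add: Q_def)
    then have "eigenvector A ?v (\<beta> + \<alpha> * N)"
      using ij by (intro eigI[of _ i]) (auto simp: S0 algebra_simps)
    with S0 show ?thesis by blast
  qed
  have ex1: "\<exists>v. eigenvector A v \<beta> \<and> S v = 0"
  proof -
    obtain i j where ij: "i < N" "j < N" "P i j \<noteq> real N * of_bool (i = j) - 1" using not_all by blast
    \<comment> \<open>The columns of \<open>N I - J - P\<close> are orthogonal to the all-ones vector and in the kernel of \<open>P\<close>.\<close>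
    let ?v = "vec N (\<lambda>i. real N * of_bool (i = j) - 1 - P i j)"
    have Pj: "(\<Sum>k<N. P k j) = 0"
      using row[OF ij(2)] sym[OF _ ij(2)] by simp
    have S0: "S ?v = 0"
      using delta(3)[OF ij(2), of "\<lambda>_. real N"] by (simp add: S_def sum_subtractf Pj)
    have "Q ?v m = 0" if m: "m < N" for m
    proof -
      have "Q ?v m = (\<Sum>k<N. real N * P m k * of_bool (k = j) - P m k - P m k * P k j)"
        unfolding Q_def by (intro sum.cong) (auto simp: algebra_simps)
      also have "\<dots> = 0"
        using m ij(2) by (simp only: sum_subtractf delta(3) square row)
      finally show ?thesis .
    qed
    then have "eigenvector A ?v \<beta>"
      using ij by (intro eigI[of _ i]) (auto simp: S0)
    with S0 show ?thesis by blast
  qed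
  show "{e. \<exists>v. eigenvector A v e \<and> v \<bullet> all_ones N = 0} = {\<beta>, \<beta> + \<alpha> * N}"
    unfolding inner using orthogonal ex1 ex2 by blast
  show "{e. eigenvalue A e} = {\<beta> + \<delta> * N, \<beta>, \<beta> + \<alpha> * N}"
    unfolding eigenvalue_def using orthogonal not_orthogonal ones ex1 ex2 by blast
qed


section \<open>Generators of principal left ideals in finite rings\<close>

lemma ring_unitsI_left_inverse:
  fixes u v :: "'a::{ring_1,finite}"
  assumes "v * u = 1"
  shows "u \<in> ring_units"
proof -
  have "inj (\<lambda>x. u * x)"
    by (rule injI) (metis assms mult.assoc mult_1_left)
  then have "surj (\<lambda>x. u * x)" by (simp add: finite_UNIV_inj_surj)
  then obtain w where w: "u * w = 1" by (metis surjD)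
  have "w = v" by (metis assms w mult.assoc mult_1_left mult_1_right)
  then show ?thesis using w assms by (auto simp: ring_units_def)
qed

lemma ring_units_mult:
  assumes "u \<in> ring_units" "v \<in> ring_units"
  shows "u * v \<in> (ring_units :: 'a::ring_1 set)"
proof -
  obtain u' v' where inv: "u * u' = 1" "u' * u = 1" "v * v' = 1" "v' * v = 1"
    using assms by (auto simp: ring_units_def)
  have "(u * v) * (v' * u') = u * (v * v') * u'" "(v' * u') * (u * v) = v' * (u' * u) * v"
    by (simp_all only: mult.assoc)
  then have "(u * v) * (v' * u') = 1" "(v' * u') * (u * v) = 1"
    by (simp_all add: inv)
  then show ?thesis unfolding ring_units_def by blast
qed

lemma one_in_ring_units: "1 \<in> ring_units"
  by (auto simp: ring_units_def)

lemma card_ring_units_pos: "card (ring_units :: 'a::{ring_1,finite} set) > 0"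
  using one_in_ring_units by (auto simp: card_gt_0_iff)

lemma bij_betw_mult_right_ring_units:
  fixes v :: "'a::ring_1"
  assumes "v \<in> ring_units"
  shows "bij_betw (\<lambda>u. u * v) ring_units ring_units"
proof -
  obtain w where w: "v * w = 1" "w * v = 1" using assms by (auto simp: ring_units_def)
  then have "w \<in> ring_units" by (auto simp: ring_units_def)
  then show ?thesis
    using assms w
    by (intro bij_betw_byWitness[where f' = "\<lambda>u. u * w"]) (auto simp: mult.assoc ring_units_mult)
qed

lemma mem_left_principal_self: "x \<in> left_principal x"
  unfolding left_principal_def by (rule range_eqI[of _ _ 1]) simp

lemma left_principal_subset_iff: "left_principal y \<subseteq> left_principal x \<longleftrightarrow> y \<in> left_principal x"
proof
  assume "y \<in> left_principal x"
  then obtain r where "y = r * x" by (auto simp: left_principal_def)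
  then have "s * y = (s * r) * x" for s by (simp only: mult.assoc)
  then show "left_principal y \<subseteq> left_principal x" by (auto simp: left_principal_def)
qed (use mem_left_principal_self[of y] in blast)

lemma zero_mem_left_principal: "0 \<in> left_principal x"
  unfolding left_principal_def by (rule range_eqI[of _ _ 0]) simp

lemma add_mem_left_principal:
  "y \<in> left_principal x \<Longrightarrow> z \<in> left_principal x \<Longrightarrow> y + z \<in> left_principal x"
  by (auto simp: left_principal_def simp flip: distrib_right)

lemma uminus_mem_left_principal: "y \<in> left_principal x \<Longrightarrow> - y \<in> left_principal x"
proof -
  assume "y \<in> left_principal x"
  then obtain r where "y = r * x" by (auto simp: left_principal_def)
  then have "- y = (- r) * x" by simp
  then show ?thesis unfolding left_principal_def by (rule range_eqI)
qed

lemma left_principal_zero: "left_principal 0 = {0}"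
  by (auto simp: left_principal_def)

text \<open>In a left ideal \<open>L\<close>, the solutions \<open>u\<close> of \<open>u * x = y\<close> form either the
  empty set or a translate of the solutions of \<open>u * x = 0\<close>; and there is a solution if and only if
  \<open>L x\<close> is all of \<open>R x\<close>, a condition that does not mention the generator \<open>y\<close>. So the solutions of
  \<open>u * x = y\<close> and of \<open>u * x = x\<close> in \<open>L\<close> are equally many. Induction on the left ideal removes
  those solutions that generate a smaller left ideal. The lemma takes the place of stable range one
  in the proof that generators of the same left ideal differ by a unit.\<close>

lemma card_generators_with_product:
  fixes x y :: "'a::{ring_1,finite}"
  assumes xy: "left_principal x = left_principal y"
  shows "card {u. left_principal u = left_principal a \<and> u * x = y} =
    card {u. left_principal u = left_principal a \<and> u * x = x}"
proof (induction "card (left_principal a)" arbitrary: a rule: less_induct)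
  case less
  let ?L = "left_principal a"
  let ?N = "\<lambda>y I. {u. left_principal u = I \<and> u * x = y}"
  let ?below = "{I \<in> range left_principal. I \<subset> ?L}"
  have in_ideal: "card {u \<in> ?L. u * x = y} = card {u \<in> ?L. u * x = x}"
  proof (cases "\<exists>u\<in>?L. u * x = y")
    case True
    then obtain s where s: "s \<in> ?L" "s * x = y" by blast
    have "x \<in> left_principal y" using xy mem_left_principal_self[of x] by simp
    then obtain b where b: "x = b * y" by (auto simp: left_principal_def)
    obtain r where r: "s = r * a" using s(1) by (auto simp: left_principal_def)
    have "b * s = (b * r) * a" by (simp only: r mult.assoc)
    then have t: "b * s \<in> ?L" by (auto simp: left_principal_def)
    have t2: "b * s * x = x" using s(2) b by (simp only: mult.assoc)
    let ?d = "s - b * s"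
    have d: "?d \<in> ?L" "?d * x = y - x"
      using t2 add_mem_left_principal[OF s(1) uminus_mem_left_principal[OF t]] s(2)
      by (simp_all add: left_diff_distrib)
    have "bij_betw (\<lambda>u. u - ?d) {u \<in> ?L. u * x = y} {u \<in> ?L. u * x = x}"
    proof (rule bij_betw_byWitness[where f' = "\<lambda>u. u + ?d"])
      have "u + ?d \<in> ?L" "u - ?d \<in> ?L" if "u \<in> ?L" for u
        using add_mem_left_principal[OF that d(1)]
          add_mem_left_principal[OF that uminus_mem_left_principal[OF d(1)]]
        by (simp_all only: diff_conv_add_uminus)
      then show "(\<lambda>u. u - ?d) ` {u \<in> ?L. u * x = y} \<subseteq> {u \<in> ?L. u * x = x}"
        "(\<lambda>u. u + ?d) ` {u \<in> ?L. u * x = x} \<subseteq> {u \<in> ?L. u * x = y}"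
        using d(2) by (auto simp: left_diff_distrib[of _ ?d] distrib_right[of _ ?d])
    qed auto
    then show ?thesis by (rule bij_betw_same_card)
  next
    case False
    have "\<not> (\<exists>u\<in>?L. u * x = x)"
    proof
      assume "\<exists>u\<in>?L. u * x = x"
      then obtain u where u: "u \<in> ?L" "u * x = x" by blast
      have "y \<in> left_principal x" using xy mem_left_principal_self[of y] by simp
      then obtain c where "y = c * x" by (auto simp: left_principal_def)
      obtain r where r: "u = r * a" using u(1) by (auto simp: left_principal_def)
      have "c * u = (c * r) * a" by (simp only: r mult.assoc)
      then have "c * u \<in> ?L" by (auto simp: left_principal_def)
      moreover have "c * u * x = y" using u(2) \<open>y = c * x\<close> by (simp only: mult.assoc)
      ultimately show False using False by blast
    qed
    then have "{u \<in> ?L. u * x = y} = {}" "{u \<in> ?L. u * x = x} = {}"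
      using False by auto
    then show ?thesis by (simp only: card.empty)
  qed
  have split: "card {u \<in> ?L. u * x = z} = card (?N z ?L) + (\<Sum>I\<in>?below. card (?N z I))" for z
  proof -
    have "{u \<in> ?L. u * x = z} = (\<Union>I\<in>insert ?L ?below. ?N z I)"
      by (auto simp: left_principal_subset_iff[symmetric] mem_left_principal_self)
    also have "card \<dots> = (\<Sum>I\<in>insert ?L ?below. card (?N z I))"
      by (rule card_UN_disjoint) auto
    finally show ?thesis by simp
  qed
  have "(\<Sum>I\<in>?below. card (?N y I)) = (\<Sum>I\<in>?below. card (?N x I))"
  proof (rule sum.cong[OF refl])
    fix I assume "I \<in> ?below"
    then obtain b where b: "I = left_principal b" "left_principal b \<subset> ?L" by blast
    then have "card (left_principal b) < card ?L" by (simp add: psubset_card_mono)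
    with b(1) show "card (?N y I) = card (?N x I)" using less[of b] by simp
  qed
  then show ?case using in_ideal split[of x] split[of y] by simp
qed

text \<open>Taking the whole ring as the left ideal, the elements that generate it are the units, and
  \<open>u * x = x\<close> has the solution \<open>1\<close> among them; so \<open>u * x = y\<close> has a unit solution too.\<close>

lemma generators_left_principal:
  fixes x :: "'a::{ring_1,finite}"
  shows "{y. left_principal y = left_principal x} = (\<lambda>u. u * x) ` ring_units"
proof (intro equalityI subsetI)
  fix y assume "y \<in> {y. left_principal y = left_principal x}"
  then have xy: "left_principal x = left_principal y" by simp
  have "1 \<in> {u. left_principal u = left_principal 1 \<and> u * x = x}" by simp
  then have "card {u. left_principal u = left_principal 1 \<and> u * x = x} \<noteq> 0"
    by (metis card_eq_0_iff empty_iff finite)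
  then have "card {u. left_principal u = left_principal 1 \<and> u * x = y} \<noteq> 0"
    using card_generators_with_product[OF xy, of 1] by simp
  then have "{u. left_principal u = left_principal 1 \<and> u * x = y} \<noteq> {}"
    by (metis card.empty)
  then obtain u where u: "left_principal u = left_principal 1" "u * x = y" by blast
  have "1 \<in> left_principal u" using u(1) mem_left_principal_self by simp
  then obtain v where "v * u = 1" by (auto simp: left_principal_def)
  then have "u \<in> ring_units" by (rule ring_unitsI_left_inverse)
  then show "y \<in> (\<lambda>u. u * x) ` ring_units" using u(2) by auto
next
  fix y assume "y \<in> (\<lambda>u. u * x) ` ring_units"
  then obtain u v where "y = u * x" "v * u = 1" by (auto simp: ring_units_def)
  then have "y \<in> left_principal x" "x = v * y"
    by (auto simp: left_principal_def simp flip: mult.assoc[of v u x])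
  then have "y \<in> left_principal x" "x \<in> left_principal y"
    by (auto simp: left_principal_def)
  then show "y \<in> {y. left_principal y = left_principal x}"
    by (auto simp: left_principal_subset_iff[symmetric])
qed


section \<open>Generating characters\<close>

text \<open>The image of \<open>1\<close> under an isomorphism from the left regular module to the character module;
  since that module is free on it, the isomorphism can be recovered from the single character.\<close>

definition generating_character :: "('a::ring_1 \<Rightarrow> complex) \<Rightarrow> bool" where
  "generating_character \<chi> \<longleftrightarrow>
    \<chi> \<in> additive_characters \<and> bij_betw (\<lambda>r. char_lact r \<chi>) UNIV additive_characters"

lemma frobenius_ring_generating_character:
  assumes "frobenius_ring TYPE('a::{ring_1,finite})"
  obtains \<chi> :: "'a::{ring_1,finite} \<Rightarrow> complex" where "generating_character \<chi>"
proof -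
  obtain \<phi> :: "'a \<Rightarrow> 'a \<Rightarrow> complex" where bij: "bij_betw \<phi> UNIV additive_characters"
    and act: "\<And>r a. \<phi> (r * a) = char_lact r (\<phi> a)"
    using assms by (auto simp: frobenius_ring_def)
  have "\<phi> = (\<lambda>r. char_lact r (\<phi> 1))"
  proof
    fix r show "\<phi> r = char_lact r (\<phi> 1)" using act[of r 1] by (simp only: mult_1_right)
  qed
  then have "generating_character (\<phi> 1)"
    using bij bij_betwE[OF bij] by (simp add: generating_character_def)
  then show ?thesis by (rule that)
qed

text \<open>The usual reason for a character sum to vanish: a permutation of the summation range multiplies
  every summand by the same factor.\<close>

lemma sum_eq_0_if_scaled:
  fixes g :: "'b \<Rightarrow> complex"
  assumes "bij_betw t S S" "\<And>s. s \<in> S \<Longrightarrow> g (t s) = c * g s" "c \<noteq> 1"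
  shows "sum g S = 0"
proof -
  have "sum g S = (\<Sum>s\<in>S. g (t s))"
    using assms(1) by (rule sum.reindex_bij_betw[symmetric])
  also have "\<dots> = c * sum g S"
    using assms(2) by (simp add: sum_distrib_left)
  finally show ?thesis using assms(3) by (simp add: algebra_simps)
qed

lemma additive_characterD:
  assumes "\<chi> \<in> additive_characters"
  shows "\<chi> (x + y) = \<chi> x * \<chi> y" "\<chi> 0 = 1" "\<chi> x = \<chi> y \<Longrightarrow> \<chi> (x - y) = 1"
proof -
  have nz: "\<chi> x \<noteq> 0" and add: "\<chi> (x + y) = \<chi> x * \<chi> y" for x y
    using assms by (auto simp: additive_characters_def)
  show "\<chi> (x + y) = \<chi> x * \<chi> y" by (rule add)
  show "\<chi> 0 = 1" using add[of 0 0] nz[of 0] by simp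
  show "\<chi> (x - y) = 1" if "\<chi> x = \<chi> y" using add[of "x - y" y] nz[of y] that by simp
qed

lemma sum_additive_character_left_ideal:
  fixes \<chi> :: "'a::{ring_1,finite} \<Rightarrow> complex"
  assumes chi: "\<chi> \<in> additive_characters" and y: "y \<in> left_principal x" "\<chi> y \<noteq> 1"
  shows "(\<Sum>z\<in>left_principal x. \<chi> z) = 0"
proof (rule sum_eq_0_if_scaled[OF _ _ y(2)])
  show "bij_betw (\<lambda>z. z + y) (left_principal x) (left_principal x)"
    using add_mem_left_principal[OF _ y(1)]
      add_mem_left_principal[OF _ uminus_mem_left_principal[OF y(1)]]
    by (intro bij_betw_byWitness[where f' = "\<lambda>z. z - y"]) auto
qed (simp add: additive_characterD[OF chi])

lemma sum_additive_character_UNIV: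
  fixes \<chi> :: "'a::{ring_1,finite} \<Rightarrow> complex"
  assumes chi: "\<chi> \<in> additive_characters" and y: "\<chi> y \<noteq> 1"
  shows "(\<Sum>z\<in>UNIV. \<chi> z) = 0"
proof -
  have "left_principal (1 :: 'a) = UNIV" by (simp add: left_principal_def)
  then show ?thesis using sum_additive_character_left_ideal[OF chi, of y 1] y by simp
qed

lemma generating_character_left:
  assumes gen: "generating_character \<chi>" and "\<And>r. \<chi> (r * x) = 1"
  shows "x = 0"
proof -
  have "char_lact x \<chi> = char_lact 0 \<chi>"
    using assms(2)[of 0] assms(2) by (auto simp: char_lact_def)
  then show ?thesis
    using gen by (auto simp: generating_character_def bij_betw_def dest: injD)
qed

text \<open>The definition treats the two sides differently, and this is the half that it does not give.
  Sum \<open>\<chi>(y * r)\<close> over all \<open>y\<close> and \<open>r\<close>. Summing over \<open>y\<close> first, only \<open>r = 0\<close> contributes, so the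
  total is \<open>|R|\<close>. Summing over \<open>r\<close> first, each \<open>y\<close> contributes \<open>|R|\<close> or \<open>0\<close>, and \<open>y = 0\<close> already
  contributes \<open>|R|\<close>; so no other \<open>y\<close> does.\<close>

lemma generating_character_right:
  fixes \<chi> :: "'a::{ring_1,finite} \<Rightarrow> complex"
  assumes gen: "generating_character \<chi>" and triv: "\<And>r. \<chi> (x * r) = 1"
  shows "x = 0"
proof (rule ccontr)
  assume x: "x \<noteq> 0"
  have chi: "\<chi> \<in> additive_characters" using gen by (simp add: generating_character_def)
  have ch_l: "(\<lambda>y. \<chi> (y * r)) \<in> additive_characters" and ch_r: "(\<lambda>y. \<chi> (r * y)) \<in> additive_characters" for r
    using chi by (auto simp: additive_characters_def distrib_left distrib_right)
  have inner: "(\<Sum>y\<in>UNIV. \<chi> (y * r)) = of_bool (r = 0) * card (UNIV :: 'a set)" for r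
  proof (cases "r = 0")
    case False
    then obtain y where "\<chi> (y * r) \<noteq> 1" using generating_character_left[OF gen] by blast
    then show ?thesis using sum_additive_character_UNIV[OF ch_l] False by simp
  qed (simp add: additive_characterD[OF chi])
  have "\<exists>m::nat. (\<Sum>r\<in>UNIV. \<chi> (y * r)) = of_nat m" for y
  proof (cases "\<forall>r. \<chi> (y * r) = 1")
    case True
    then show ?thesis by (auto intro: exI[of _ "card (UNIV :: 'a set)"])
  next
    case False
    then show ?thesis using sum_additive_character_UNIV[OF ch_r] by (metis of_nat_0)
  qed
  then obtain m :: "'a \<Rightarrow> nat" where m: "\<And>y. (\<Sum>r\<in>UNIV. \<chi> (y * r)) = of_nat (m y)" by metis
  have "of_nat (\<Sum>y\<in>UNIV. m y) = (\<Sum>y\<in>UNIV. \<Sum>r\<in>UNIV. \<chi> (y * r))" by (simp add: m)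
  also have "\<dots> = (\<Sum>r\<in>(UNIV :: 'a set). if r = 0 then of_nat (card (UNIV :: 'a set)) else 0)"
    by (subst sum.swap) (auto simp: inner intro!: sum.cong)
  also have "\<dots> = of_nat (card (UNIV :: 'a set))"
    by simp
  finally have total: "(\<Sum>y\<in>UNIV. m y) = card (UNIV :: 'a set)" by (simp only: of_nat_eq_iff)
  have "m 0 = card (UNIV :: 'a set)" "m x = card (UNIV :: 'a set)"
    using m[of 0] m[of x] by (simp_all add: triv additive_characterD[OF chi])
  moreover have "(\<Sum>y\<in>{0, x}. m y) \<le> (\<Sum>y\<in>UNIV. m y)"
    by (rule sum_mono2) auto
  moreover have "card (UNIV :: 'a set) > 0" by (simp add: card_gt_0_iff)
  ultimately show False using x total by simp
qed

text \<open>Each character \<open>x \<mapsto> \<chi>(v * x)\<close> is \<open>x \<mapsto> \<chi>(x * \<sigma> v)\<close> for some \<open>\<sigma> v\<close> (the Nakayama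
  automorphism), and \<open>\<sigma>\<close> permutes the units. The weight is defined through left multiplication by
  units, but characters of a left linear code arise from right multiplication; this lemma passes
  from one to the other.\<close>

lemma sum_generating_character_units_commute:
  fixes \<chi> :: "'a::{ring_1,finite} \<Rightarrow> complex"
  assumes gen: "generating_character \<chi>"
  shows "(\<Sum>u\<in>ring_units. \<chi> (u * x)) = (\<Sum>u\<in>ring_units. \<chi> (x * u))"
proof -
  have chi: "\<chi> \<in> additive_characters" using gen by (simp add: generating_character_def)
  have "\<exists>s. \<forall>x. \<chi> (v * x) = \<chi> (x * s)" for v
  proof -
    have "(\<lambda>x. \<chi> (v * x)) \<in> additive_characters"
      using chi by (auto simp: additive_characters_def distrib_left)
    then obtain s where "(\<lambda>x. \<chi> (v * x)) = char_lact s \<chi>"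
      using gen by (auto simp: generating_character_def bij_betw_def)
    then show ?thesis by (auto simp: char_lact_def fun_eq_iff)
  qed
  then obtain \<sigma> where \<sigma>: "\<And>v x. \<chi> (v * x) = \<chi> (x * \<sigma> v)" by metis
  have unit: "\<sigma> v \<in> ring_units" if v: "v \<in> ring_units" for v
  proof -
    obtain w where w: "w * v = 1" using v by (auto simp: ring_units_def)
    have "\<chi> (r * (\<sigma> w * \<sigma> v - 1)) = 1" for r
    proof -
      have "\<chi> (r * (\<sigma> w * \<sigma> v)) = \<chi> (w * (v * r))"
        using \<sigma>[of w "v * r"] \<sigma>[of v "r * \<sigma> w"] by (simp add: mult.assoc)
      also have "w * (v * r) = r" by (simp add: w flip: mult.assoc)
      finally show ?thesis
        using additive_characterD(3)[OF chi] by (simp add: right_diff_distrib)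
    qed
    then have "\<sigma> w * \<sigma> v - 1 = 0" by (rule generating_character_left[OF gen])
    then show ?thesis by (intro ring_unitsI_left_inverse[of "\<sigma> w"]) simp
  qed
  have "inj_on \<sigma> ring_units"
  proof (rule inj_onI)
    fix v w assume eq: "\<sigma> v = \<sigma> w"
    have "\<chi> ((v - w) * r) = 1" for r
      using additive_characterD(3)[OF chi, of "v * r" "w * r"] \<sigma>[of v r] \<sigma>[of w r] eq
      by (simp add: left_diff_distrib)
    then have "v - w = 0" by (rule generating_character_right[OF gen])
    then show "v = w" by simp
  qed
  moreover have "\<sigma> ` ring_units \<subseteq> ring_units" using unit by blast
  ultimately have "bij_betw \<sigma> ring_units ring_units"
    by (metis bij_betw_def endo_inj_surj finite)
  then have "(\<Sum>u\<in>ring_units. \<chi> (x * \<sigma> u)) = (\<Sum>u\<in>ring_units. \<chi> (x * u))"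
    by (rule sum.reindex_bij_betw)
  moreover have "(\<Sum>u\<in>ring_units. \<chi> (u * x)) = (\<Sum>u\<in>ring_units. \<chi> (x * \<sigma> u))"
    by (intro sum.cong refl) (rule \<sigma>)
  ultimately show ?thesis by simp
qed


section \<open>The homogeneous weight as a character sum\<close>

lemma lmoebius_inversion:
  fixes g :: "'a::{ring_1,finite} set \<Rightarrow> 'b::comm_ring_1"
  assumes J: "J \<in> range left_principal"
  shows "(\<Sum>K | K \<in> range left_principal \<and> K \<subseteq> J.
      of_int (lmoebius K J) * (\<Sum>I | I \<in> range left_principal \<and> I \<subseteq> K. g I)) = g J"
proof -
  let ?P = "range (left_principal :: 'a \<Rightarrow> 'a set)"
  have "(\<Sum>K | K \<in> ?P \<and> K \<subseteq> J. of_int (lmoebius K J) * (\<Sum>I | I \<in> ?P \<and> I \<subseteq> K. g I))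
      = (\<Sum>K | K \<in> ?P \<and> K \<subseteq> J. \<Sum>I | I \<in> {I. I \<in> ?P \<and> I \<subseteq> J} \<and> I \<subseteq> K. of_int (lmoebius K J) * g I)"
    unfolding sum_distrib_left by (intro sum.cong) auto
  also have "\<dots> = (\<Sum>I | I \<in> ?P \<and> I \<subseteq> J. \<Sum>K | K \<in> {K. K \<in> ?P \<and> K \<subseteq> J} \<and> I \<subseteq> K. of_int (lmoebius K J) * g I)"
    by (rule sum.swap_restrict) auto
  also have "\<dots> = (\<Sum>I | I \<in> ?P \<and> I \<subseteq> J. if I = J then g J else 0)"
  proof (rule sum.cong[OF refl])
    fix I assume "I \<in> {I. I \<in> ?P \<and> I \<subseteq> J}"
    then have I: "I \<in> ?P" "I \<subseteq> J" by auto
    have set_eq: "{K. K \<in> {K. K \<in> ?P \<and> K \<subseteq> J} \<and> I \<subseteq> K} = {K \<in> ?P. I \<subseteq> K \<and> K \<subseteq> J}"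
      by auto
    have "(\<Sum>K \<in> {K \<in> ?P. I \<subseteq> K \<and> K \<subseteq> J}. lmoebius K J) = (if I = J then 1 else 0)"
    proof (cases "I = J")
      case True
      then have "{K \<in> ?P. I \<subseteq> K \<and> K \<subseteq> J} = {J}" using J by auto
      then show ?thesis using True by (simp add: lmoebius_refl)
    next
      case False
      then show ?thesis using lmoebius_sum[OF I(1), of J] I(2) by simp
    qed
    then have "of_int (\<Sum>K \<in> {K \<in> ?P. I \<subseteq> K \<and> K \<subseteq> J}. lmoebius K J) * g I = (if I = J then g J else 0)"
      by simp
    then show "(\<Sum>K | K \<in> {K. K \<in> ?P \<and> K \<subseteq> J} \<and> I \<subseteq> K. of_int (lmoebius K J) * g I) = (if I = J then g J else 0)"
      unfolding set_eq by (simp add: sum_distrib_right)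
  qed
  also have "\<dots> = g J" using J by simp
  finally show ?thesis .
qed

text \<open>The sum of a generating character over \<open>R x\<close> is \<open>0\<close> unless \<open>x = 0\<close>. Grouping the elements of
  \<open>R x\<close> by the left ideal they generate turns this into the relation whose Moebius inverse is the
  claim.\<close>

lemma lmoebius_eq_sum_generators:
  fixes \<chi> :: "'a::{ring_1,finite} \<Rightarrow> complex"
  assumes gen: "generating_character \<chi>"
  shows "of_int (lmoebius {0} (left_principal x)) = (\<Sum>y\<in>(\<lambda>u. u * x) ` ring_units. \<chi> y)"
proof -
  let ?P = "range (left_principal :: 'a \<Rightarrow> 'a set)"
  define g where "g I = (\<Sum>y | left_principal y = I. \<chi> y)" for I
  have chi: "\<chi> \<in> additive_characters" using gen by (simp add: generating_character_def)
  have zero: "{0} \<in> ?P" by (metis left_principal_zero rangeI)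
  have below: "(\<Sum>I | I \<in> ?P \<and> I \<subseteq> K. g I) = (if K = {0} then 1 else 0)" if K: "K \<in> ?P" for K
  proof -
    obtain z where z: "K = left_principal z" using K by blast
    have "(\<Sum>I | I \<in> ?P \<and> I \<subseteq> K. g I)
        = (\<Sum>I | I \<in> ?P \<and> I \<subseteq> K. \<Sum>y | y \<in> K \<and> left_principal y = I. \<chi> y)"
      unfolding g_def using mem_left_principal_self by (intro sum.cong) blast+
    also have "\<dots> = (\<Sum>y\<in>K. \<chi> y)"
      by (rule sum.group) (use left_principal_subset_iff in \<open>auto simp: z\<close>)
    also have "\<dots> = (if K = {0} then 1 else 0)"
    proof (cases "z = 0")
      case True
      then show ?thesis by (simp add: z left_principal_zero additive_characterD[OF chi])
    next
      case False
      then obtain r where "\<chi> (r * z) \<noteq> 1" using generating_character_left[OF gen] by blast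
      then have "(\<Sum>y\<in>K. \<chi> y) = 0"
        unfolding z by (intro sum_additive_character_left_ideal[OF chi]) (auto simp: left_principal_def)
      moreover have "K \<noteq> {0}" using False mem_left_principal_self[of z] by (auto simp: z)
      ultimately show ?thesis by simp
    qed
    finally show ?thesis .
  qed
  have "(\<Sum>y\<in>(\<lambda>u. u * x) ` ring_units. \<chi> y) = g (left_principal x)"
    by (simp add: g_def generators_left_principal)
  also have "\<dots> = (\<Sum>K | K \<in> ?P \<and> K \<subseteq> left_principal x.
      of_int (lmoebius K (left_principal x)) * (\<Sum>I | I \<in> ?P \<and> I \<subseteq> K. g I))"
    by (rule lmoebius_inversion[symmetric]) simp
  also have "\<dots> = (\<Sum>K | K \<in> ?P \<and> K \<subseteq> left_principal x.
      if K = {0} then of_int (lmoebius {0} (left_principal x)) else 0)"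
    by (intro sum.cong) (auto simp: below)
  also have "\<dots> = of_int (lmoebius {0} (left_principal x))"
    using zero by (simp add: zero_mem_left_principal)
  finally show ?thesis by simp
qed

text \<open>Averaging over the units replaces the sum over the orbit of \<open>x\<close>, which has
  the orbit size as its denominator in the weight, by a sum over all units.\<close>

lemma hom_weight_eq_character_sum:
  fixes \<chi> :: "'a::{ring_1,finite} \<Rightarrow> complex"
  assumes gen: "generating_character \<chi>"
  shows "complex_of_real (hom_weight \<gamma> x) =
    \<gamma> * (1 - (\<Sum>u\<in>ring_units. \<chi> (x * u)) / card (ring_units :: 'a set))"
proof -
  let ?U = "ring_units :: 'a set" and ?O = "(\<lambda>u. u * x) ` ring_units"
  define T where "T y = (\<Sum>u\<in>?U. \<chi> (u * y))" for y
  have T_orbit: "T y = T x" if y: "y \<in> ?O" for y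
  proof -
    obtain v where v: "v \<in> ?U" "y = v * x" using y by blast
    have "T y = (\<Sum>u\<in>?U. \<chi> ((u * v) * x))" by (simp add: T_def v mult.assoc)
    also have "\<dots> = T x"
      unfolding T_def
      by (rule sum.reindex_bij_betw[OF bij_betw_mult_right_ring_units[OF v(1)]])
    finally show ?thesis .
  qed
  have orbit_sum: "(\<Sum>y\<in>?O. \<chi> (u * y)) = (\<Sum>y\<in>?O. \<chi> y)" if u: "u \<in> ?U" for u
  proof -
    obtain v where v: "u * v = 1" "v * u = 1" using u by (auto simp: ring_units_def)
    then have v_unit: "v \<in> ?U" by (auto simp: ring_units_def)
    have closed: "w * y \<in> ?O" if w: "w \<in> ?U" and y: "y \<in> ?O" for w y
    proof -
      obtain t where "t \<in> ?U" "y = t * x" using y by blast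
      then show ?thesis
        using ring_units_mult[OF w, of t] by (intro image_eqI[of _ _ "w * t"]) (auto simp: mult.assoc)
    qed
    have cancel: "v * (u * y) = y" "u * (v * y) = y" for y
      by (simp_all add: v flip: mult.assoc)
    have "bij_betw (\<lambda>y. u * y) ?O ?O"
      using closed[OF u] closed[OF v_unit] cancel
      by (intro bij_betw_byWitness[where f' = "\<lambda>y. v * y"]) blast+
    then show ?thesis by (rule sum.reindex_bij_betw)
  qed
  have "of_nat (card ?U) * (\<Sum>y\<in>?O. \<chi> y) = (\<Sum>u\<in>?U. \<Sum>y\<in>?O. \<chi> (u * y))"
    using orbit_sum by simp
  also have "\<dots> = (\<Sum>y\<in>?O. T y)"
    unfolding T_def by (rule sum.swap)
  also have "\<dots> = of_nat (card ?O) * T x"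
    using T_orbit by simp
  finally have "of_nat (card ?U) * of_int (lmoebius {0} (left_principal x)) = of_nat (card ?O) * T x"
    by (simp only: lmoebius_eq_sum_generators[OF gen])
  moreover have "card ?O \<noteq> 0"
    using one_in_ring_units by (auto simp: card_eq_0_iff)
  ultimately have "complex_of_int (lmoebius {0} (left_principal x)) / of_nat (card ?O) = T x / of_nat (card ?U)"
    using card_ring_units_pos[where 'a = 'a]
    by (simp add: frac_eq_eq mult.commute)
  then have "complex_of_real (hom_weight \<gamma> x) = \<gamma> * (1 - T x / of_nat (card ?U))"
    by (simp add: hom_weight_def)
  then show ?thesis
    by (simp only: T_def sum_generating_character_units_commute[OF gen])
qed

lemma hom_weight_zero: "hom_weight \<gamma> (0 :: 'a::{ring_1,finite}) = 0"
proof -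
  have "(\<lambda>u::'a. u * 0) ` ring_units = {0}" using one_in_ring_units by auto
  then show ?thesis by (simp add: hom_weight_def left_principal_zero lmoebius_refl)
qed

lemma hom_weight_uminus: "hom_weight \<gamma> (- x) = hom_weight \<gamma> (x :: 'a::{ring_1,finite})"
proof -
  have "left_principal (- x) = left_principal x"
    using uminus_mem_left_principal[OF mem_left_principal_self, of x]
      uminus_mem_left_principal[OF mem_left_principal_self, of "- x"]
    by (intro equalityI) (simp_all add: left_principal_subset_iff)
  then show ?thesis
    by (simp only: hom_weight_def generators_left_principal[symmetric])
qed


section \<open>The characters of a code given by its coordinates\<close>

lemma left_linear_codeD:
  assumes C: "left_linear_code n C"
  shows left_linear_code_carrier: "c \<in> C \<Longrightarrow> c \<in> carrier_vec n"
    and left_linear_code_zero: "0\<^sub>v n \<in> C"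
    and left_linear_code_add: "c \<in> C \<Longrightarrow> d \<in> C \<Longrightarrow> c + d \<in> C"
    and left_linear_code_smult: "c \<in> C \<Longrightarrow> r \<cdot>\<^sub>v c \<in> C"
    and left_linear_code_minus: "c \<in> C \<Longrightarrow> d \<in> C \<Longrightarrow> c - d \<in> C"
proof -
  show carrier: "c \<in> carrier_vec n" if "c \<in> C" for c
    using C that by (auto simp: left_linear_code_def)
  show "0\<^sub>v n \<in> C" and add: "c \<in> C \<Longrightarrow> d \<in> C \<Longrightarrow> c + d \<in> C" and smult: "c \<in> C \<Longrightarrow> r \<cdot>\<^sub>v c \<in> C" for c d r
    using C by (auto simp: left_linear_code_def)
  show "c - d \<in> C" if c: "c \<in> C" and d: "d \<in> C"
  proof -
    have "c - d = c + (- 1) \<cdot>\<^sub>v d"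
      using carrier[OF c] carrier[OF d] by (intro eq_vecI) auto
    then show ?thesis using add[OF c smult[OF d]] by simp
  qed
qed

lemma finite_left_linear_code:
  fixes C :: "'a::{ring_1,finite} vec set"
  assumes C: "left_linear_code n C"
  shows "finite C"
proof (rule finite_surj)
  show "finite {xs :: 'a list. set xs \<subseteq> UNIV \<and> length xs = n}"
    by (rule finite_lists_length_eq) simp
  show "C \<subseteq> vec_of_list ` {xs. set xs \<subseteq> UNIV \<and> length xs = n}"
  proof
    fix c assume "c \<in> C"
    then have "dim_vec c = n" using left_linear_code_carrier[OF C] by auto
    then show "c \<in> vec_of_list ` {xs. set xs \<subseteq> UNIV \<and> length xs = n}"
      by (intro image_eqI[of _ _ "list_of_vec c"]) (auto simp: vec_list)
  qed
qed

lemma regular_code_coordinate_surj: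
  assumes "regular_code n C" "j < n"
  shows "(\<lambda>c. c $ j) ` C = UNIV"
proof -
  obtain l Y where "generator_matrix l n Y C" "\<forall>j<n. (\<lambda>x. x \<bullet> col Y j) ` carrier_vec l = UNIV"
    using assms(1) by (auto simp: regular_code_def)
  then show ?thesis using assms(2) by (simp add: generator_matrix_def image_image)
qed

lemma projective_code_coordinates:
  assumes proj: "projective_code n C" and i: "i < n" and j: "j < n" and ij: "i \<noteq> j"
    and r: "\<forall>c\<in>C. c $ i = c $ j * r" and s: "\<forall>c\<in>C. c $ j = c $ i * s"
  shows False
proof -
  obtain l Y where Y: "generator_matrix l n Y C"
    and ne: "\<forall>i<n. \<forall>j<n. i \<noteq> j \<longrightarrow> right_span (col Y i) \<noteq> right_span (col Y j)"
    using proj unfolding projective_code_def by blast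
  have "right_span (col Y i) = right_span (col Y j)"
    unfolding right_span_eq_iff col_in_right_span_iff[OF Y i j] col_in_right_span_iff[OF Y j i]
    using r s by blast
  with ne i j ij show False by blast
qed

text \<open>The values of a nonzero linear functional on \<open>C\<close> contain a nonzero left ideal, on which a generating
  character is not trivial; so \<open>\<chi> \<circ> f\<close> is a nontrivial character of \<open>C\<close>.\<close>

lemma sum_generating_character_code:
  fixes C :: "'a::{ring_1,finite} vec set" and \<chi> :: "'a \<Rightarrow> complex"
  assumes gen: "generating_character \<chi>" and C: "left_linear_code n C"
    and add: "\<And>c d. c \<in> C \<Longrightarrow> d \<in> C \<Longrightarrow> f (c + d) = f c + f d"
    and smult: "\<And>r c. c \<in> C \<Longrightarrow> f (r \<cdot>\<^sub>v c) = r * f c"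
    and d: "d \<in> C" "f d \<noteq> 0"
  shows "(\<Sum>c\<in>C. \<chi> (f c)) = 0"
proof -
  have chi: "\<chi> \<in> additive_characters" using gen by (simp add: generating_character_def)
  obtain r where r: "\<chi> (r * f d) \<noteq> 1" using generating_character_left[OF gen] d(2) by blast
  let ?e = "r \<cdot>\<^sub>v d"
  have e: "?e \<in> C" using left_linear_code_smult[OF C d(1)] .
  note car = left_linear_code_carrier[OF C]
  show ?thesis
  proof (rule sum_eq_0_if_scaled)
    show "bij_betw (\<lambda>c. c + ?e) C C"
    proof (rule bij_betw_byWitness[where f' = "\<lambda>c. c - ?e"])
      show "\<forall>c\<in>C. c + ?e - ?e = c" "\<forall>c\<in>C. c - ?e + ?e = c"
        using car[OF e] by (auto dest!: car intro!: eq_vecI)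
    qed (use left_linear_code_add[OF C _ e] left_linear_code_minus[OF C _ e] in blast)+
    show "\<chi> (f (c + ?e)) = \<chi> (r * f d) * \<chi> (f c)" if "c \<in> C" for c
      using that e d(1) by (simp add: add smult additive_characterD[OF chi])
  qed (fact r)
qed

text \<open>If the functionals \<open>c_i u\<close> and \<open>c_j v\<close> agree on \<open>C\<close>, then the columns \<open>i\<close> and \<open>j\<close> of a
  generator matrix are unit multiples of each other, so \<open>i = j\<close> by projectivity; and
  a codeword with \<open>c_i = 1\<close>, which exists by regularity, then shows \<open>u = v\<close>.\<close>

lemma code_characters_orthogonal:
  fixes C :: "'a::{ring_1,finite} vec set" and \<chi> :: "'a \<Rightarrow> complex"
  assumes gen: "generating_character \<chi>" and C: "left_linear_code n C"
    and reg: "regular_code n C" and proj: "projective_code n C"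
    and i: "i < n" and j: "j < n" and u: "u \<in> ring_units" and v: "v \<in> ring_units"
  shows "(\<Sum>c\<in>C. \<chi> (c $ i * u - c $ j * v)) = (if (i, u) = (j, v) then card C else 0)"
proof (cases "(i, u) = (j, v)")
  case True
  have "\<chi> 0 = 1" using gen by (intro additive_characterD) (simp add: generating_character_def)
  with True show ?thesis by simp
next
  case False
  have "\<exists>c\<in>C. c $ i * u - c $ j * v \<noteq> 0"
  proof (rule ccontr)
    assume "\<not> ?thesis"
    then have eq: "c $ i * u = c $ j * v" if "c \<in> C" for c using that by auto
    show False
    proof (cases "i = j")
      case True
      have "1 \<in> (\<lambda>c. c $ i) ` C" using regular_code_coordinate_surj[OF reg i] by simp
      then obtain c where "c \<in> C" "c $ i = 1" by auto
      then show False using eq[of c] True False by simp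
    next
      case ne: False
      obtain u' v' where u': "u * u' = 1" and v': "v * v' = 1"
        using u v by (auto simp: ring_units_def)
      have "c $ i = c $ j * (v * u')" "c $ j = c $ i * (u * v')" if "c \<in> C" for c
        using eq[OF that] u' v' by (metis mult.assoc mult_1_right)+
      then show False using projective_code_coordinates[OF proj i j ne] by blast
    qed
  qed
  then obtain d where d: "d \<in> C" "d $ i * u - d $ j * v \<noteq> 0" by blast
  have "(\<Sum>c\<in>C. \<chi> (c $ i * u - c $ j * v)) = 0"
    using i j d left_linear_code_carrier[OF C]
    by (intro sum_generating_character_code[OF gen C]) 
      (auto simp: distrib_right right_diff_distrib mult.assoc dest!: left_linear_code_carrier[OF C])
  with False show ?thesis by auto
qed

lemma sum_code_character:
  fixes C :: "'a::{ring_1,finite} vec set" and \<chi> :: "'a \<Rightarrow> complex"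
  assumes gen: "generating_character \<chi>" and C: "left_linear_code n C"
    and reg: "regular_code n C" and i: "i < n" and u: "u \<in> ring_units"
  shows "(\<Sum>c\<in>C. \<chi> (- (c $ i * u))) = 0"
proof -
  have "1 \<in> (\<lambda>c. c $ i) ` C" using regular_code_coordinate_surj[OF reg i] by simp
  then obtain d where d: "d \<in> C" "d $ i = 1" by auto
  have "u \<noteq> 0" using u by (auto simp: ring_units_def)
  then show ?thesis
    using i d
    by (intro sum_generating_character_code[OF gen C _ _ d(1)])
      (auto simp: distrib_right mult.assoc dest!: left_linear_code_carrier[OF C])
qed

text \<open>The sum of the characters \<open>c \<mapsto> \<chi>(c_i u)\<close> at \<open>x - y\<close>, for \<open>\<gamma> \<noteq> 0\<close>. Writing it through the weight
  shows that it is real and does not depend on \<open>\<chi>\<close>.\<close>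

definition code_kernel :: "real \<Rightarrow> 'a::{ring_1,finite} vec \<Rightarrow> 'a vec \<Rightarrow> real" where
  "code_kernel \<gamma> x y =
    card (ring_units :: 'a set) * (dim_vec y - hom_weight_vec \<gamma> (x - y) / \<gamma>)"

lemma code_kernel_eq_character_sum:
  fixes x y :: "'a::{ring_1,finite} vec" and \<chi> :: "'a \<Rightarrow> complex"
  assumes gen: "generating_character \<chi>" and gamma: "\<gamma> \<noteq> 0"
    and x: "x \<in> carrier_vec n" and y: "y \<in> carrier_vec n"
  shows "complex_of_real (code_kernel \<gamma> x y) =
    (\<Sum>(i, u)\<in>{..<n} \<times> ring_units. \<chi> (x $ i * u - y $ i * u))"
proof -
  let ?m = "complex_of_nat (card (ring_units :: 'a set))"
  have m: "?m \<noteq> 0" using card_ring_units_pos[where 'a = 'a] by (simp add: card_gt_0_iff)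
  have "complex_of_real (hom_weight_vec \<gamma> (x - y)) =
      (\<Sum>i<n. \<gamma> * (1 - (\<Sum>u\<in>ring_units. \<chi> (x $ i * u - y $ i * u)) / ?m))"
    using x y
    by (auto simp: hom_weight_vec_def hom_weight_eq_character_sum[OF gen] left_diff_distrib intro!: sum.cong)
  also have "\<dots> = \<gamma> * (n - (\<Sum>i<n. \<Sum>u\<in>ring_units. \<chi> (x $ i * u - y $ i * u)) / ?m)"
    by (simp add: sum_subtractf flip: sum_distrib_left sum_divide_distrib)
  finally show ?thesis
    using y gamma m by (simp add: code_kernel_def sum.cartesian_product)
qed

lemma code_kernel_sym:
  fixes x y :: "'a::{ring_1,finite} vec"
  assumes x: "x \<in> carrier_vec n" and y: "y \<in> carrier_vec n"
  shows "code_kernel \<gamma> x y = code_kernel \<gamma> y x"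
proof -
  have "hom_weight_vec \<gamma> (x - y) = hom_weight_vec \<gamma> (y - x)"
    unfolding hom_weight_vec_def
  proof (intro sum.cong)
    show "{..<dim_vec (x - y)} = {..<dim_vec (y - x)}" using x y by auto
    fix i assume "i \<in> {..<dim_vec (y - x)}"
    then show "hom_weight \<gamma> ((x - y) $ i) = hom_weight \<gamma> ((y - x) $ i)"
      using x y hom_weight_uminus[of \<gamma> "x $ i - y $ i"] by simp
  qed
  then show ?thesis using x y by (simp add: code_kernel_def)
qed

lemma code_kernel_row_sum:
  fixes C :: "'a::{ring_1,finite} vec set" and \<chi> :: "'a \<Rightarrow> complex"
  assumes gen: "generating_character \<chi>" and C: "left_linear_code n C"
    and reg: "regular_code n C" and gamma: "\<gamma> \<noteq> 0" and x: "x \<in> C"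
  shows "(\<Sum>z\<in>C. code_kernel \<gamma> x z) = 0"
proof -
  let ?P = "{..<n} \<times> (ring_units :: 'a set)"
  note car = left_linear_code_carrier[OF C]
  have chi: "\<chi> \<in> additive_characters" using gen by (simp add: generating_character_def)
  have diff: "\<chi> (a - b) = \<chi> a * \<chi> (- b)" for a b
    using additive_characterD(1)[OF chi, of a "- b"] by simp
  have "complex_of_real (\<Sum>z\<in>C. code_kernel \<gamma> x z) =
      (\<Sum>z\<in>C. \<Sum>(i, u)\<in>?P. \<chi> (x $ i * u) * \<chi> (- (z $ i * u)))"
    using x by (simp add: code_kernel_eq_character_sum[OF gen gamma car car] diff)
  also have "\<dots> = (\<Sum>(i, u)\<in>?P. \<chi> (x $ i * u) * (\<Sum>z\<in>C. \<chi> (- (z $ i * u))))"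
    by (subst sum.swap) (simp add: sum_distrib_left case_prod_unfold)
  also have "\<dots> = 0"
    by (intro sum.neutral) (auto simp: sum_code_character[OF gen C reg])
  finally show ?thesis by (simp only: of_real_eq_0_iff)
qed

text \<open>This is the convolution of the sum of the characters \<open>c \<mapsto> \<chi>(c_i u)\<close> with itself: different
  characters convolve to zero, and each one convolved with itself is \<open>|C|\<close> times itself.\<close>

lemma code_kernel_square:
  fixes C :: "'a::{ring_1,finite} vec set" and \<chi> :: "'a \<Rightarrow> complex"
  assumes gen: "generating_character \<chi>" and C: "left_linear_code n C"
    and reg: "regular_code n C" and proj: "projective_code n C" and gamma: "\<gamma> \<noteq> 0"
    and x: "x \<in> C" and y: "y \<in> C"
  shows "(\<Sum>z\<in>C. code_kernel \<gamma> x z * code_kernel \<gamma> z y) = card C * code_kernel \<gamma> x y"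
proof -
  let ?P = "{..<n} \<times> (ring_units :: 'a set)"
  note car = left_linear_code_carrier[OF C]
  note kernel = code_kernel_eq_character_sum[OF gen gamma car car]
  have chi: "\<chi> \<in> additive_characters" using gen by (simp add: generating_character_def)
  \<comment> \<open>Separates the summation variable \<open>z\<close>, which is in \<open>b\<close> and \<open>c\<close>, from \<open>x\<close> and \<open>y\<close>.\<close>
  have split: "\<chi> (a - b) * \<chi> (c - d) = \<chi> (a - d) * \<chi> (c - b)" for a b c d
    using additive_characterD(1)[OF chi, of "a - b" "c - d"]
      additive_characterD(1)[OF chi, of "a - d" "c - b"] by (simp add: algebra_simps)
  have "complex_of_real (\<Sum>z\<in>C. code_kernel \<gamma> x z * code_kernel \<gamma> z y) =
      (\<Sum>z\<in>C. \<Sum>p\<in>?P. \<Sum>q\<in>?P. \<chi> (x $ fst p * snd p - y $ fst q * snd q) *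
        \<chi> (z $ fst q * snd q - z $ fst p * snd p))"
    using x y by (simp add: kernel sum_product case_prod_unfold split)
  also have "\<dots> = (\<Sum>p\<in>?P. \<Sum>q\<in>?P. \<chi> (x $ fst p * snd p - y $ fst q * snd q) *
        (\<Sum>z\<in>C. \<chi> (z $ fst q * snd q - z $ fst p * snd p)))"
    by (subst sum.swap, rule sum.cong[OF refl], subst sum.swap) (simp add: sum_distrib_left)
  also have "\<dots> = (\<Sum>p\<in>?P. \<Sum>q\<in>?P. if q = p then card C * \<chi> (x $ fst p * snd p - y $ fst p * snd p) else 0)"
  proof (intro sum.cong refl)
    fix p q assume "p \<in> ?P" "q \<in> ?P"
    then show "\<chi> (x $ fst p * snd p - y $ fst q * snd q) *
        (\<Sum>z\<in>C. \<chi> (z $ fst q * snd q - z $ fst p * snd p)) =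
        (if q = p then card C * \<chi> (x $ fst p * snd p - y $ fst p * snd p) else 0)"
      using code_characters_orthogonal[OF gen C reg proj, of "fst q" "fst p" "snd q" "snd p"]
      by (cases p, cases q) auto
  qed
  also have "\<dots> = card C * (\<Sum>p\<in>?P. \<chi> (x $ fst p * snd p - y $ fst p * snd p))"
    by (simp add: sum_distrib_left)
  also have "\<dots> = complex_of_real (card C * code_kernel \<gamma> x y)"
    using x y by (simp add: kernel case_prod_unfold)
  finally show ?thesis by (simp only: of_real_eq_iff)
qed


section \<open>Two-weight codes\<close>

theorem corollary14:
  fixes C :: "'a::{ring_1,finite} vec set" and n :: nat and \<gamma> w1 w2 :: real
  assumes "frobenius_ring TYPE('a)"
    and "left_linear_code n C"
    and "proper_code \<gamma> n C"
    and "regular_code n C"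
    and "projective_code n C"
    and "two_weight_code \<gamma> C w1 w2"
  shows "\<exists>k l m :: nat. \<exists>\<rho>1 \<rho>2 :: real.
    strongly_regular C (code_adj \<gamma> w1) (card C) k l m \<and>
    (\<forall>vs. distinct vs \<and> set vs = C \<longrightarrow>
      (let A = adjacency_mat (code_adj \<gamma> w1) vs; j = all_ones (card C) in
        {e. eigenvalue A e} = {real k, \<rho>1, \<rho>2} \<and>
        eigenvector A j (real k) \<and>
        {e. \<exists>v. eigenvector A v e \<and> v \<bullet> j = 0} = {\<rho>1, \<rho>2})) \<and>
    (w2 - w1) * real k = w2 * (real (card C) - 1) - \<gamma> * real n * real (card C) \<and>
    (w2 - w1) * \<rho>1 = - w2 \<and>
    (w2 - w1) * \<rho>2 = - w2 + \<gamma> * real (card C) / real (card (ring_units :: 'a set))"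
proof -
  obtain \<chi> :: "'a \<Rightarrow> complex" where gen: "generating_character \<chi>"
    using assms(1) by (rule frobenius_ring_generating_character)
  note C = assms(2)
  note car = left_linear_code_carrier[OF C]
  let ?w = "hom_weight_vec \<gamma> :: 'a vec \<Rightarrow> real"
  let ?B = "code_kernel \<gamma> :: 'a vec \<Rightarrow> 'a vec \<Rightarrow> real"
  have fin: "finite C" using C by (rule finite_left_linear_code)
  have zero: "0\<^sub>v n \<in> C" using C by (rule left_linear_code_zero)
  have less: "w1 < w2" and weights: "{?w c | c. c \<in> C \<and> ?w c \<noteq> 0} = {w1, w2}"
    using assms(6) by (auto simp: two_weight_code_def)
  have "w1 \<in> {?w c | c. c \<in> C \<and> ?w c \<noteq> 0}" "w2 \<in> {?w c | c. c \<in> C \<and> ?w c \<noteq> 0}"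
    unfolding weights by auto
  then obtain c1 c2 where c1: "c1 \<in> C" "?w c1 = w1" "w1 \<noteq> 0" and c2: "c2 \<in> C" "?w c2 = w2" "w2 \<noteq> 0"
    by auto
  have w_cases: "?w c \<in> {0, w1, w2}" if "c \<in> C" for c
    using weights that by auto
  have w_zero: "?w (0\<^sub>v n) = 0" by (simp add: hom_weight_vec_def hom_weight_zero)
  have gamma: "\<gamma> \<noteq> 0" using c1 by (auto simp: hom_weight_vec_def hom_weight_def)
  have n: "n > 0"
  proof (rule ccontr)
    assume "\<not> n > 0"
    then have "?w c1 = 0" using car[OF c1(1)] by (simp add: hom_weight_vec_def)
    with c1 show False by simp
  qed
  have units: "card (ring_units :: 'a set) > 0" by (rule card_ring_units_pos)
  define N where "N = card C"
  have N: "N > 0" using fin zero by (auto simp: N_def card_gt_0_iff)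
  \<comment> \<open>The coefficients of \<open>I\<close>, \<open>J\<close> and \<open>B\<close> in the adjacency matrix, obtained by solving
    \<open>w\<^sub>1 A + w\<^sub>2 (J - I - A) = \<gamma> (n J - B / U)\<close> for \<open>A\<close>.\<close>
  define \<beta> where "\<beta> = - w2 / (w2 - w1)"
  define \<delta> where "\<delta> = (w2 - \<gamma> * n) / (w2 - w1)"
  define \<alpha> where "\<alpha> = \<gamma> / (card (ring_units :: 'a set) * (w2 - w1))"
  have diff_zero: "x - y = 0\<^sub>v n \<longleftrightarrow> x = y" if "x \<in> C" "y \<in> C" for x y
  proof
    assume eq: "x - y = 0\<^sub>v n"
    show "x = y"
    proof (rule eq_vecI)
      fix i assume "i < dim_vec y"
      then have "i < n" "(x - y) $ i = x $ i - y $ i" using car[OF that(2)] by auto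
      then show "x $ i = y $ i" using eq by simp
    qed (use car[OF that(1)] car[OF that(2)] in auto)
  qed (use car[OF that(2)] in auto)
  have adj: "of_bool (code_adj \<gamma> w1 x y) = \<beta> * of_bool (x = y) + \<delta> + \<alpha> * ?B x y"
    if x: "x \<in> C" and y: "y \<in> C" for x y
  proof -
    have w0: "?w (x - y) = 0 \<longleftrightarrow> x = y"
      using assms(3) left_linear_code_minus[OF C x y] diff_zero[OF x y] w_zero
      by (auto simp: proper_code_def)
    have cancel: "\<gamma> / (m * D) * (m * (n - v / \<gamma>)) = (\<gamma> * n - v) / D"
      if "m > 0" "D > 0" for m D v :: real
      using that gamma by (simp add: field_simps)
    have "\<alpha> * ?B x y = (\<gamma> * n - ?w (x - y)) / (w2 - w1)"
      using units less car[OF y] unfolding \<alpha>_def code_kernel_def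
      by (subst cancel[symmetric, of "card (ring_units :: 'a set)"]) auto
    then have "\<beta> * of_bool (x = y) + \<delta> + \<alpha> * ?B x y = (w2 - w2 * of_bool (x = y) - ?w (x - y)) / (w2 - w1)"
      by (simp add: \<beta>_def \<delta>_def diff_divide_distrib)
    also have "\<dots> = of_bool (code_adj \<gamma> w1 x y)"
      using w_cases[OF left_linear_code_minus[OF C x y]] w0 c1(3) c2(3) less
      by (auto simp: code_adj_def)
    finally show ?thesis by simp
  qed
  have sym: "?B x y = ?B y x" if "x \<in> C" "y \<in> C" for x y
    using car that by (intro code_kernel_sym) auto
  have row: "(\<Sum>z\<in>C. ?B x z) = 0" if "x \<in> C" for x
    using code_kernel_row_sum[OF gen C assms(4) gamma that] .
  have square: "(\<Sum>z\<in>C. ?B x z * ?B z y) = N * ?B x y" if "x \<in> C" "y \<in> C" for x y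
    using code_kernel_square[OF gen C assms(4,5) gamma that] by (simp add: N_def)
  have irrefl: "\<not> code_adj \<gamma> w1 x x" if "x \<in> C" for x
    using diff_zero[OF that that] w_zero c1(3) by (simp add: code_adj_def)
  obtain k l m where srg: "strongly_regular C (code_adj \<gamma> w1) N k l m"
    using strongly_regular_if_kernel[OF fin irrefl adj sym row] square by (auto simp: N_def)
  \<comment> \<open>The zero codeword and one of \<open>c1\<close>, \<open>c2\<close> give the entries showing that \<open>B\<close> is neither
    \<open>0\<close> nor \<open>N I - J\<close>.\<close>
  have B_ne: "?B (0\<^sub>v n) (0\<^sub>v n) \<noteq> 0"
    using n units w_zero by (simp add: code_kernel_def card_gt_0_iff)
  have ne_zero: "c1 \<noteq> 0\<^sub>v n" "c2 \<noteq> 0\<^sub>v n" using c1 c2 w_zero by auto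
  have "?B c1 (0\<^sub>v n) \<noteq> ?B c2 (0\<^sub>v n)"
  proof -
    have "c1 - 0\<^sub>v n = c1" "c2 - 0\<^sub>v n = c2" using car[OF c1(1)] car[OF c2(1)] by auto
    then show ?thesis using c1 c2 less units gamma by (simp add: code_kernel_def card_gt_0_iff)
  qed
  then obtain c where c: "c \<in> C" "c \<noteq> 0\<^sub>v n" "?B c (0\<^sub>v n) \<noteq> - 1"
    using c1(1) c2(1) ne_zero by metis
  have spectrum:
    "eigenvector (adjacency_mat (code_adj \<gamma> w1) vs) (all_ones N) (\<beta> + \<delta> * N)"
    "{e. \<exists>v. eigenvector (adjacency_mat (code_adj \<gamma> w1) vs) v e \<and> v \<bullet> all_ones N = 0} = {\<beta>, \<beta> + \<alpha> * N}"
    "{e. eigenvalue (adjacency_mat (code_adj \<gamma> w1) vs) e} = {\<beta> + \<delta> * N, \<beta>, \<beta> + \<alpha> * N}"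
    if vs: "distinct vs" "set vs = C" for vs
  proof -
    have len: "length vs = N" using vs distinct_card by (fastforce simp: N_def)
    have nth: "vs ! i \<in> C" if "i < N" for i using that len vs by auto
    have bij: "bij_betw ((!) vs) {..<N} C"
      using vs len by (intro bij_betw_nth) auto
    note reindex = sum.reindex_bij_betw[OF bij]
    have ex: "\<exists>i<N. vs ! i = x" if "x \<in> C" for x
      using that vs len by (auto simp: in_set_conv_nth)
    define P where "P i j = ?B (vs ! i) (vs ! j)" for i j
    have A: "adjacency_mat (code_adj \<gamma> w1) vs = mat N N (\<lambda>(i, j). \<beta> * of_bool (i = j) + \<delta> + \<alpha> * P i j)"
    proof (rule eq_matI)
      fix i j
      assume "i < dim_row (mat N N (\<lambda>(i, j). \<beta> * of_bool (i = j) + \<delta> + \<alpha> * P i j))"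
        "j < dim_col (mat N N (\<lambda>(i, j). \<beta> * of_bool (i = j) + \<delta> + \<alpha> * P i j))"
      then have ij: "i < N" "j < N" by simp_all
      then have "vs ! i = vs ! j \<longleftrightarrow> i = j" using vs len by (simp add: nth_eq_iff_index_eq)
      then show "adjacency_mat (code_adj \<gamma> w1) vs $$ (i, j) =
          mat N N (\<lambda>(i, j). \<beta> * of_bool (i = j) + \<delta> + \<alpha> * P i j) $$ (i, j)"
        using ij len adj[OF nth[OF ij(1)] nth[OF ij(2)]]
        by (simp add: adjacency_mat_def P_def of_bool_def)
    qed (simp_all add: adjacency_mat_def len)
    have P_sym: "P i j = P j i" if "i < N" "j < N" for i j
      using that sym nth by (simp add: P_def)
    have P_row: "(\<Sum>k<N. P i k) = 0" if "i < N" for i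
      using reindex[of "?B (vs ! i)"] row[OF nth[OF that]] by (simp add: P_def)
    have P_square: "(\<Sum>k<N. P i k * P k j) = N * P i j" if "i < N" "j < N" for i j
      using reindex[of "\<lambda>z. ?B (vs ! i) z * ?B z (vs ! j)"] square[OF nth nth] that
      by (simp add: P_def)
    obtain i0 where i0: "i0 < N" "vs ! i0 = 0\<^sub>v n" using ex[OF zero] by blast
    obtain i1 where i1: "i1 < N" "vs ! i1 = c" using ex[OF c(1)] by blast
    have "\<exists>i<N. \<exists>j<N. P i j \<noteq> 0"
      using i0 B_ne by (auto simp: P_def intro!: exI[of _ i0])
    moreover have "P i1 i0 \<noteq> real N * of_bool (i1 = i0) - 1"
      using i0 i1 c by (auto simp: P_def)
    then have "\<exists>i<N. \<exists>j<N. P i j \<noteq> real N * of_bool (i = j) - 1"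
      using i0(1) i1(1) by blast
    ultimately have exist: "\<exists>i<N. \<exists>j<N. P i j \<noteq> 0"
      "\<exists>i<N. \<exists>j<N. P i j \<noteq> real N * of_bool (i = j) - 1"
      by blast+
    note spectrum_P = spectrum_if_kernel[where P = P, OF N P_sym P_row P_square exist]
    show
      "eigenvector (adjacency_mat (code_adj \<gamma> w1) vs) (all_ones N) (\<beta> + \<delta> * N)"
      "{e. \<exists>v. eigenvector (adjacency_mat (code_adj \<gamma> w1) vs) v e \<and> v \<bullet> all_ones N = 0} = {\<beta>, \<beta> + \<alpha> * N}"
      "{e. eigenvalue (adjacency_mat (code_adj \<gamma> w1) vs) e} = {\<beta> + \<delta> * N, \<beta>, \<beta> + \<alpha> * N}"
      unfolding A by (rule spectrum_P; assumption)+
  qed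
  have k: "real k = \<beta> + \<delta> * N"
  proof -
    have "real k = real (card {z \<in> C. code_adj \<gamma> w1 (0\<^sub>v n) z})"
      using srg zero by (simp add: strongly_regular_def)
    also have "\<dots> = (\<Sum>z\<in>C. of_bool (code_adj \<gamma> w1 (0\<^sub>v n) z))"
      using sum.inter_filter[OF fin, of "\<lambda>_. 1::real"] by (simp add: of_bool_def)
    also have "\<dots> = (\<Sum>z\<in>C. \<beta> * of_bool (0\<^sub>v n = z) + \<delta> + \<alpha> * ?B (0\<^sub>v n) z)"
      using adj[OF zero] by (intro sum.cong) auto
    also have "\<dots> = \<beta> + \<delta> * N + \<alpha> * (\<Sum>z\<in>C. ?B (0\<^sub>v n) z)"
      using fin zero by (simp add: sum.distrib N_def flip: sum_distrib_left)
    finally show ?thesis by (simp add: row[OF zero])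
  qed
  show ?thesis
  proof (intro exI conjI allI impI)
    show "strongly_regular C (code_adj \<gamma> w1) (card C) k l m" using srg by (simp add: N_def)
    show "let A = adjacency_mat (code_adj \<gamma> w1) vs; j = all_ones (card C) in
        {e. eigenvalue A e} = {real k, \<beta>, \<beta> + \<alpha> * N} \<and>
        eigenvector A j (real k) \<and>
        {e. \<exists>v. eigenvector A v e \<and> v \<bullet> j = 0} = {\<beta>, \<beta> + \<alpha> * N}"
      if "distinct vs \<and> set vs = C" for vs
      using spectrum[of vs] that unfolding Let_def k N_def[symmetric] by blast
    have scaled: "(w2 - w1) * \<beta> = - w2" "(w2 - w1) * \<delta> = w2 - \<gamma> * n"
      "(w2 - w1) * \<alpha> = \<gamma> / card (ring_units :: 'a set)"
      using less by (simp_all add: \<alpha>_def \<beta>_def \<delta>_def)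
    then show "(w2 - w1) * \<beta> = - w2" by simp
    show "(w2 - w1) * real k = w2 * (real (card C) - 1) - \<gamma> * real n * real (card C)"
      by (simp add: k N_def distrib_left scaled flip: mult.assoc) (simp add: algebra_simps)
    show "(w2 - w1) * (\<beta> + \<alpha> * N) = - w2 + \<gamma> * real (card C) / real (card (ring_units :: 'a set))"
      by (simp add: N_def distrib_left scaled flip: mult.assoc)
  qed
qed

end
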